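(* Let $d\ge 2$. For any Schwartz function $f$ on $\mathbb{R}^d$ and any $x\in\mathbb{R}^d$, $$\int_0^\infty|\omega_t*f(x)|^2\,t^{d-1}\,dt=\int_0^\infty|\widehat{\omega_r}*f(x)|^2\,r^{d-1}\,dr.$$
   Context: $\omega_r$ denotes the normalized surface measure (total mass $1$) on the sphere $rS^{d-1}\subset\mathbb{R}^d$. Its Fourier transform is $\widehat{\omega_r}(\xi)=\int e^{-2\pi i y\cdot\xi}\,d\omega_r(y)$, and $*$ denotes convolution on $\mathbb{R}^d$. *)

theory Defs
  imports "HOL-Analysis.Analysis"
begin

section \<open>Schwartz functions\<close>

definition partial_deriv :: "'d \<Rightarrow> (real ^ 'd \<Rightarrow> complex) \<Rightarrow> real ^ 'd \<Rightarrow> complex" where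
  "partial_deriv i f x = vector_derivative (\<lambda>t. f (x + t *\<^sub>R axis i 1)) (at 0)"

text \<open>
  The mixed derivative \<open>\<partial>\<^sub>i \<partial>\<^sub>j \<dots> f\<close> is indexed by the list \<open>[i, j, \<dots>]\<close> of directions
  rather than by a multi-index. For smooth functions the order in the list is immaterial,
  and every multi-index is the count function of some list.
\<close>
definition iter_partial :: "'d list \<Rightarrow> (real ^ 'd \<Rightarrow> complex) \<Rightarrow> real ^ 'd \<Rightarrow> complex" where
  "iter_partial is f = foldr partial_deriv is f"

text \<open>
  Differentiability below is total (Frechet) differentiability on the whole space; required of
  all iterated partial derivatives, it amounts to \<open>C\<^sup>\<infinity>\<close>, and it guarantees that the
  derivatives in \<open>iter_partial\<close> exist.
\<close>
definition smooth :: "(real ^ 'd \<Rightarrow> complex) \<Rightarrow> bool" where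
  "smooth f \<longleftrightarrow> (\<forall>is. iter_partial is f differentiable_on UNIV)"

definition multi_power :: "real ^ 'd \<Rightarrow> ('d \<Rightarrow> nat) \<Rightarrow> real" where
  "multi_power x \<alpha> = (\<Prod>i\<in>UNIV. (x $ i) ^ \<alpha> i)"

definition schwartz :: "(real ^ 'd \<Rightarrow> complex) \<Rightarrow> bool" where
  "schwartz f \<longleftrightarrow> smooth f \<and>
     (\<forall>\<alpha> is. bounded (range (\<lambda>x. of_real (multi_power x \<alpha>) * iter_partial is f x)))"


section \<open>Surface measure on spheres\<close>

text \<open>
  Surface measure \<open>\<sigma>\<^sub>r\<close> on the sphere of radius \<open>r\<close> in \<open>\<real>\<^sup>d\<close>, defined as usual by polar
  coordinates: \<open>\<sigma>\<^sub>r(A) = d r\<^sup>d\<^sup>-\<^sup>1 \<lambda>{s \<theta> | 0 < s < 1, |\<theta>| = 1, r \<theta> \<in> A}\<close> for \<open>A\<close> contained in the sphere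
  and \<open>r > 0\<close>, that is, as a multiple of the image of Lebesgue measure on the unit ball under
  radial projection. The value of the projection at the origin is irrelevant. It is a Borel
  measure on the whole space that is concentrated on the sphere.
\<close>
definition surface_measure :: "real \<Rightarrow> (real ^ 'd) measure" where
  "surface_measure r =
     scale_measure (ennreal (real CARD('d) * r ^ (CARD('d) - 1)))
       (distr (restrict_space lborel (ball 0 1)) borel (\<lambda>y. (r / norm y) *\<^sub>R y))"

definition sphere_measure :: "real \<Rightarrow> (real ^ 'd) measure" where
  "sphere_measure r = uniform_measure (surface_measure r) (sphere 0 r)"


section \<open>Fourier transform and convolution\<close>

definition fourier_measure :: "(real ^ 'd) measure \<Rightarrow> real ^ 'd \<Rightarrow> complex" where
  "fourier_measure \<mu> \<xi> = (LINT y|\<mu>. exp (- 2 * of_real pi * \<i> * of_real (y \<bullet> \<xi>)))"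

definition conv_measure :: "(real ^ 'd) measure \<Rightarrow> (real ^ 'd \<Rightarrow> complex) \<Rightarrow> real ^ 'd \<Rightarrow> complex" where
  "conv_measure \<mu> f x = (LINT y|\<mu>. f (x - y))"

definition conv_fun ::
    "(real ^ 'd \<Rightarrow> complex) \<Rightarrow> (real ^ 'd \<Rightarrow> complex) \<Rightarrow> real ^ 'd \<Rightarrow> complex" where
  "conv_fun g f x = (LINT y|lborel. g y * f (x - y))"


section \<open>Sanity checks for the sphere measure\<close>

lemma emeasure_surface_measure:
  fixes A :: "(real ^ 'd) set"
  assumes "A \<in> sets borel"
  shows "emeasure (surface_measure r) A =
    ennreal (real CARD('d) * r ^ (CARD('d) - 1)) *
    emeasure lborel {y \<in> ball 0 1. (r / norm y) *\<^sub>R y \<in> A}"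
proof -
  have m: "(\<lambda>y::real^'d. (r / norm y) *\<^sub>R y) \<in> restrict_space lborel (ball 0 1) \<rightarrow>\<^sub>M borel"
    by (rule measurable_restrict_space1) simp
  have "emeasure (restrict_space lborel (ball 0 1))
          ((\<lambda>y. (r / norm y) *\<^sub>R y) -` A \<inter> space (restrict_space lborel (ball 0 1))) =
        emeasure lborel {y \<in> ball 0 1. (r / norm y) *\<^sub>R y \<in> A}"
    by (subst emeasure_restrict_space)
       (auto simp: space_restrict_space intro!: arg_cong[where f = "emeasure lborel"])
  then show ?thesis
    using assms m by (simp add: surface_measure_def emeasure_distr)
qed

lemma sets_sphere_measure [simp, measurable_cong]: "sets (sphere_measure r) = sets borel"
  by (simp add: sphere_measure_def surface_measure_def)

lemma emeasure_sphere_measure: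
  assumes "r > 0"
  shows "emeasure (sphere_measure r :: (real ^ 'd) measure) (sphere 0 r) = 1"
    and "emeasure (sphere_measure r :: (real ^ 'd) measure) UNIV = 1"
proof -
  let ?S = "sphere 0 r :: (real ^ 'd) set" and ?B = "ball 0 1 :: (real ^ 'd) set"
  let ?M = "surface_measure r :: (real ^ 'd) measure"
  have S: "?S \<in> sets ?M" and U: "UNIV \<in> sets ?M"
    by (auto simp: surface_measure_def)
  have eq: "{y \<in> ?B. (r / norm y) *\<^sub>R y \<in> ?S} = ?B - {0}"
    using assms by auto
  have "emeasure lborel (?B - {0}) = emeasure lborel ?B"
    by (rule emeasure_Diff_null_set) auto
  moreover have "emeasure lborel ?B = ennreal (measure lborel ?B)"
    using emeasure_lborel_ball_finite[of "0 :: real ^ 'd" 1] by (intro emeasure_eq_ennreal_measure) auto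
  moreover have "measure lborel ?B > 0"
    by (rule content_ball_pos) simp
  ultimately have e: "emeasure ?M ?S =
      ennreal (real CARD('d) * r ^ (CARD('d) - 1)) * ennreal (measure lborel ?B)"
    by (subst emeasure_surface_measure, simp, subst eq) simp
  have nz: "emeasure ?M ?S \<noteq> 0" and fin: "emeasure ?M ?S \<noteq> \<infinity>"
    using assms \<open>measure lborel ?B > 0\<close> by (auto simp: e ennreal_mult_eq_top_iff)
  show "emeasure (sphere_measure r :: (real ^ 'd) measure) (sphere 0 r) = 1"
    unfolding sphere_measure_def using S nz fin
    by (simp add: emeasure_uniform_measure ennreal_divide_self top.not_eq_extremum)
  show "emeasure (sphere_measure r :: (real ^ 'd) measure) UNIV = 1"
    unfolding sphere_measure_def using S U nz fin
    by (simp add: emeasure_uniform_measure ennreal_divide_self top.not_eq_extremum)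
qed

end

theory Submission
  imports Defs "HOL-Probability.Probability"
begin

text \<open>
  Fix \<open>x\<close> and put \<open>g y = f (x - y)\<close>, so that \<open>\<omega>\<^sub>t * f(x)\<close> is the mean \<open>A(t)\<close> of \<open>g\<close> over the sphere of
  radius \<open>t\<close>. Since the Fourier transform of \<open>\<omega>\<^sub>r\<close> is radial, polar coordinates show that the
  transform of the radial function \<open>y \<mapsto> A(|y|)\<close> at \<open>\<xi>\<close> is the convolution of \<open>f\<close> with the transform
  of \<open>\<omega>\<^sub>r\<close> for \<open>r = |\<xi>|\<close>, evaluated at \<open>x\<close>. The identity is thus Plancherel's theorem for this radial
  function, written in polar coordinates. The function is continuous, bounded and integrable, and for
  such functions Plancherel follows by inserting the factor \<open>exp (- \<pi> \<epsilon>\<^sup>2 |\<xi>|\<^sup>2)\<close>, moving it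
  to the other side as an approximate identity, and letting \<open>\<epsilon>\<close> tend to \<open>0\<close>.
\<close>

section \<open>Fourier transform and Plancherel's theorem\<close>

text \<open>\<open>lborel\<close> is the image of the product of one-dimensional Lebesgue measures
  under the coordinate map, so Fubini for finite products applies. It serves the Gaussians and the
  integrability of Schwartz functions.\<close>

lemma
  assumes "\<And>b. b \<in> Basis \<Longrightarrow> integrable lborel (f b)"
  shows integrable_lborel_prod:
      "integrable lborel (\<lambda>x::'a::euclidean_space. \<Prod>b\<in>Basis. f b (x \<bullet> b) :: _::{real_normed_field,banach,second_countable_topology})" (is ?I)
    and integral_lborel_prod:
      "(LINT x|lborel. (\<Prod>b\<in>Basis. f b ((x::'a) \<bullet> b))) = (\<Prod>b\<in>Basis. LINT t|lborel. f b t)" (is ?E)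
proof -
  interpret product_sigma_finite "\<lambda>_. lborel :: real measure"
    by standard
  have m: "f b \<in> borel_measurable borel" if "b \<in> Basis" for b
    using assms[OF that] by (auto dest: borel_measurable_integrable)
  have [measurable]: "(\<lambda>x::'a. \<Prod>b\<in>Basis. f b (x \<bullet> b)) \<in> borel_measurable borel"
    using m by (intro borel_measurable_prod measurable_compose[OF _ m]) auto
  have eq: "(\<Prod>b\<in>Basis. f b ((\<Sum>c\<in>Basis. x c *\<^sub>R c :: 'a) \<bullet> b)) = (\<Prod>b\<in>Basis. f b (x b))" for x
    by (intro prod.cong) auto
  show ?I
    by (subst lborel_eq, subst integrable_distr_eq)
       (auto simp: eq assms intro!: product_integrable_prod)
  show ?E
    by (subst lborel_eq, subst integral_distr)
       (auto simp: eq assms intro!: product_integral_prod)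
qed

text \<open>Both parts follow from the self-similarity of \<open>lborel\<close> under x \<mapsto> t
  + c x, with Jacobian \<open>\<bar>c\<bar> ^ DIM('a)\<close>. For a non-integrable \<open>f\<close>
  both sides of the first identity are the default value 0.\<close>

lemma
  fixes f :: "'a::euclidean_space \<Rightarrow> 'b::{banach, second_countable_topology}"
  assumes [measurable]: "f \<in> borel_measurable borel" and c: "c \<noteq> 0"
  shows integral_lborel_affine:
      "(LINT x|lborel. f x) = \<bar>c\<bar> ^ DIM('a) *\<^sub>R (LINT x|lborel. f (t + c *\<^sub>R x))"
    and integrable_lborel_affine_iff:
      "integrable lborel (\<lambda>x. f (t + c *\<^sub>R x)) \<longleftrightarrow> integrable lborel f"
proof -
  have L: "lborel = density (distr lborel borel (\<lambda>x. t + c *\<^sub>R x)) (\<lambda>_. ennreal (\<bar>c\<bar> ^ DIM('a)))"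
    using lborel_affine[OF c, of t] by simp
  show "(LINT x|lborel. f x) = \<bar>c\<bar> ^ DIM('a) *\<^sub>R (LINT x|lborel. f (t + c *\<^sub>R x))"
    by (subst L, subst integral_density, simp_all add: integral_distr)
  have "integrable lborel f \<longleftrightarrow> integrable lborel (\<lambda>x. \<bar>c\<bar> ^ DIM('a) *\<^sub>R f (t + c *\<^sub>R x))"
    by (subst L, subst integrable_density) (simp_all add: integrable_distr_eq)
  also have "\<dots> \<longleftrightarrow> integrable lborel (\<lambda>x. f (t + c *\<^sub>R x))"
    using integrable_scaleR_right[of "inverse (\<bar>c\<bar> ^ DIM('a))" lborel "\<lambda>x. \<bar>c\<bar> ^ DIM('a) *\<^sub>R f (t + c *\<^sub>R x)"]
      integrable_scaleR_right[of "\<bar>c\<bar> ^ DIM('a)" lborel "\<lambda>x. f (t + c *\<^sub>R x)"] c by auto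
  finally show "integrable lborel (\<lambda>x. f (t + c *\<^sub>R x)) \<longleftrightarrow> integrable lborel f" ..
qed

lemma nn_integral_lborel_affine:
  fixes f :: "'a::euclidean_space \<Rightarrow> ennreal"
  assumes [measurable]: "f \<in> borel_measurable borel" and c: "c \<noteq> 0"
  shows "(\<integral>\<^sup>+x. f x \<partial>lborel) = ennreal (\<bar>c\<bar> ^ DIM('a)) * (\<integral>\<^sup>+x. f (t + c *\<^sub>R x) \<partial>lborel)"
  by (subst lborel_affine[OF c, of t])
     (simp add: nn_integral_density nn_integral_distr nn_integral_cmult)

lemma borel_measurable_cnj [measurable]: "cnj \<in> borel_measurable borel"
  by (intro borel_measurable_continuous_onI continuous_intros)

section \<open>The exponential character and the Fourier transform of functions\<close>

text \<open>The character in the exact syntactic form of the integrand of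
  \<open>fourier_measure\<close>, so that transforms of measures and of functions share one set of
  rules.\<close>

definition wave :: "real \<Rightarrow> complex" where
  "wave u = exp (- 2 * of_real pi * \<i> * of_real u)"

lemma norm_wave [simp]: "norm (wave u) = 1"
  by (simp add: wave_def norm_exp_eq_Re)

lemma wave_0 [simp]: "wave 0 = 1"
  by (simp add: wave_def)

lemma wave_add: "wave (u + v) = wave u * wave v"
  by (simp add: wave_def algebra_simps flip: exp_add)

lemma cnj_wave: "cnj (wave u) = wave (- u)"
  by (simp add: wave_def exp_cnj)

lemma wave_sum: "finite A \<Longrightarrow> wave (\<Sum>i\<in>A. u i) = (\<Prod>i\<in>A. wave (u i))"
  by (induction rule: finite_induct) (auto simp: wave_add)

lemma continuous_on_wave [continuous_intros]:
  "continuous_on A u \<Longrightarrow> continuous_on A (\<lambda>x. wave (u x))"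
  unfolding wave_def by (intro continuous_intros)

lemma borel_measurable_wave [measurable]: "wave \<in> borel_measurable borel"
  by (intro borel_measurable_continuous_onI continuous_intros)

definition fourier :: "('a::euclidean_space \<Rightarrow> complex) \<Rightarrow> 'a \<Rightarrow> complex" where
  "fourier f \<xi> = (LINT y|lborel. f y * wave (y \<bullet> \<xi>))"

lemma borel_measurable_fourier [measurable]:
  assumes [measurable]: "f \<in> borel_measurable borel"
  shows "fourier f \<in> borel_measurable borel"
  unfolding fourier_def[abs_def] by measurable

lemma integrable_mult_wave:
  assumes "integrable M f" and [measurable]: "u \<in> borel_measurable M"
  shows "integrable M (\<lambda>y. f y * wave (u y))"
  using assms(1) by (rule Bochner_Integration.integrable_bound)
    (use assms(1)[THEN borel_measurable_integrable] in \<open>auto simp: norm_mult\<close>)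

lemma norm_fourier_le:
  shows "norm (fourier f \<xi>) \<le> (LINT y|lborel. norm (f y))"
proof -
  have "norm (fourier f \<xi>) \<le> (LINT y|lborel. norm (f y * wave (y \<bullet> \<xi>)))"
    unfolding fourier_def by (rule integral_norm_bound)
  then show ?thesis
    by (simp add: norm_mult)
qed

text \<open>Conjugation reverses the sign in the character, and the substitution y \<mapsto> -y
  restores it. This makes the squared modulus of a transform a product of two transforms.\<close>

lemma cnj_fourier:
  assumes [measurable]: "f \<in> borel_measurable borel"
  shows "cnj (fourier f \<xi>) = fourier (\<lambda>y. cnj (f (- y))) \<xi>"
proof -
  have "cnj (fourier f \<xi>) = (LINT y|lborel. cnj (f y * wave (y \<bullet> \<xi>)))"
    unfolding fourier_def by (rule integral_bounded_linear'[OF bounded_linear_cnj bounded_linear_cnj, symmetric]) simp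
  also have "\<dots> = fourier (\<lambda>y. cnj (f (- y))) \<xi>"
    unfolding fourier_def
    by (subst integral_lborel_affine[where c = "-1" and t = 0]) (auto simp: cnj_wave)
  finally show ?thesis .
qed

text \<open>The multiplication formula: the kernel \<open>wave (y \<bullet> \<xi>)\<close> is
  symmetric and of modulus 1, so Fubini moves the transform from one factor to the other.\<close>

lemma integral_mult_fourier:
  fixes f h :: "'a::euclidean_space \<Rightarrow> complex"
  assumes f: "integrable lborel f" and h: "integrable lborel h"
  shows "(LINT \<xi>|lborel. fourier f \<xi> * h \<xi>) = (LINT y|lborel. f y * fourier h y)"
proof -
  have [measurable]: "f \<in> borel_measurable borel" "h \<in> borel_measurable borel"
    using f h by (auto dest: borel_measurable_integrable)
  let ?F = "\<lambda>y \<xi>. f y * h \<xi> * wave (y \<bullet> \<xi>)"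
  have "integrable (lborel \<Otimes>\<^sub>M lborel) (case_prod ?F)"
  proof (rule lborel_pair.Fubini_integrable)
    show "integrable lborel (\<lambda>y. LINT \<xi>|lborel. norm (case (y, \<xi>) of (y, \<xi>) \<Rightarrow> ?F y \<xi>))"
      using f h by (simp add: norm_mult)
    show "AE y in lborel. integrable lborel (\<lambda>\<xi>. case (y, \<xi>) of (y, \<xi>) \<Rightarrow> ?F y \<xi>)"
      using f h by (auto intro!: integrable_mult_wave)
  qed measurable
  from lborel_pair.Fubini_integral[OF this] show ?thesis
    by (simp add: fourier_def inner_commute ac_simps flip: integral_mult_right_zero integral_mult_left_zero)
qed

section \<open>Gaussians and their transforms\<close>

text \<open>A rescaling of the characteristic function of the standard normal distribution: the
  dilation by \<open>sqrt (2 * pi)\<close> turns exp(-t^2/2) into exp(-pi t^2), and its Jacobian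
  cancels the normalization of the density.\<close>

lemma integrable_std_gauss: "integrable lborel (\<lambda>t::real. complex_of_real (exp (- (pi * t\<^sup>2))))"
 and fourier_std_gauss: "(LINT t|lborel. complex_of_real (exp (- (pi * t\<^sup>2))) * wave (t * u)) = of_real (exp (- (pi * u\<^sup>2)))"
proof -
  let ?s = "sqrt (2 * pi)"
  have s: "?s > 0" "?s * ?s = 2 * pi" by simp_all
  have e: "exp (- (pi * t\<^sup>2)) = ?s * std_normal_density (0 + ?s * t)" for t
    by (simp add: std_normal_density_def power_mult_distrib)
  show I: "integrable lborel (\<lambda>t::real. complex_of_real (exp (- (pi * t\<^sup>2))))"
    unfolding e using s
    by (intro integrable_of_real integrable_mult_right lborel_integrable_real_affine integrable_normal_density) auto
  \<comment> \<open>Evaluation at \<open>- ?s * u\<close> makes the phase -2 pi t u after the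
    substitution t \<mapsto> \<open>?s * t\<close>, the sign and scale of
    \<open>wave\<close>.\<close>
  have "complex_of_real (exp (- (- ?s * u)\<^sup>2 / 2)) = (LINT t|lborel. std_normal_density t *\<^sub>R iexp (- ?s * u * t))"
    using fun_cong[OF char_std_normal_distribution, of "- ?s * u"]
    by (simp add: char_def integral_density)
  also have "\<dots> = \<bar>?s\<bar> *\<^sub>R (LINT t|lborel. std_normal_density (0 + ?s * t) *\<^sub>R iexp (- ?s * u * (0 + ?s * t)))"
    using s by (intro lborel_integral_real_affine) auto
  also have "\<dots> = (LINT t|lborel. complex_of_real (exp (- (pi * t\<^sup>2))) * wave (t * u))"
  proof -
    have w: "iexp (- ?s * u * (0 + ?s * t)) = wave (t * u)" for t
    proof -
      have "- ?s * u * (0 + ?s * t) = - 2 * pi * (t * u)"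
        using s(2) by (metis (no_types, opaque_lifting) add_0 minus_mult_left mult.assoc mult.commute)
      then show ?thesis by (simp add: wave_def mult_ac)
    qed
    show ?thesis
      unfolding e w using s(1) by (simp add: scaleR_conv_of_real mult.assoc
          flip: integral_mult_right_zero)
  qed
  finally show "(LINT t|lborel. complex_of_real (exp (- (pi * t\<^sup>2))) * wave (t * u)) = of_real (exp (- (pi * u\<^sup>2)))"
    by (simp add: power_mult_distrib)
qed

definition gauss :: "'a::euclidean_space \<Rightarrow> complex" where
  "gauss x = of_real (exp (- (pi * (norm x)\<^sup>2)))"

lemma borel_measurable_gauss [measurable]: "gauss \<in> borel_measurable borel"
  unfolding gauss_def by measurable

lemma gauss_prod: "gauss x = (\<Prod>b\<in>Basis. complex_of_real (exp (- (pi * (x \<bullet> b)\<^sup>2))))"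
  by (simp add: gauss_def norm_eq_sqrt_inner euclidean_inner[of x x] sum_nonneg
        sum_distrib_left exp_sum power2_eq_square flip: of_real_prod sum_negf)

lemma integrable_gauss [simp]: "integrable lborel gauss"
  unfolding gauss_prod by (rule integrable_lborel_prod, rule integrable_std_gauss)

text \<open>The Gaussian and the character both factor over the coordinates, which reduces the claim
  to dimension one.\<close>

lemma fourier_gauss: "fourier gauss = gauss"
proof
  fix \<xi> :: 'a
  have "fourier gauss \<xi> = (LINT y|lborel. (\<Prod>b\<in>Basis. complex_of_real (exp (- (pi * (y \<bullet> b)\<^sup>2))) * wave (y \<bullet> b * (\<xi> \<bullet> b))))"
    by (simp add: fourier_def gauss_prod euclidean_inner[of _ \<xi>] wave_sum prod.distrib)
  also have "\<dots> = gauss \<xi>"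
    by (subst integral_lborel_prod)
       (auto intro!: integrable_mult_wave integrable_std_gauss simp: fourier_std_gauss gauss_prod)
  finally show "fourier gauss \<xi> = gauss \<xi>" .
qed

lemma integral_gauss: "(LINT x|lborel. gauss x) = 1"
  using fun_cong[OF fourier_gauss, of 0] by (simp add: fourier_def gauss_def)


text \<open>The extra character translates the frequency from z to y + z, and a dilation by e
  becomes one by 1/e with factor e^(-d). As a function of z the result is an approximate identity of
  width e around -y.\<close>

lemma fourier_scaled_gauss:
  fixes y z :: "'a::euclidean_space"
  assumes e: "e \<noteq> 0"
  shows "fourier (\<lambda>\<xi>. gauss (e *\<^sub>R \<xi>) * wave (y \<bullet> \<xi>)) z =
    of_real (inverse (\<bar>e\<bar> ^ DIM('a))) * gauss (inverse e *\<^sub>R (y + z))"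
proof -
  have "gauss (inverse e *\<^sub>R (y + z)) = (LINT x|lborel. gauss x * wave (x \<bullet> (inverse e *\<^sub>R (y + z))))"
    by (subst fourier_gauss[symmetric]) (simp add: fourier_def)
  also have "\<dots> = \<bar>e\<bar> ^ DIM('a) *\<^sub>R (LINT x|lborel. gauss (0 + e *\<^sub>R x) * wave ((0 + e *\<^sub>R x) \<bullet> (inverse e *\<^sub>R (y + z))))"
    by (rule integral_lborel_affine) (use e in auto)
  also have "(LINT x|lborel. gauss (0 + e *\<^sub>R x) * wave ((0 + e *\<^sub>R x) \<bullet> (inverse e *\<^sub>R (y + z)))) =
      fourier (\<lambda>\<xi>. gauss (e *\<^sub>R \<xi>) * wave (y \<bullet> \<xi>)) z"
    using e by (simp add: fourier_def inner_add_right wave_add inner_commute ac_simps mult.assoc[symmetric, of e])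
  finally show ?thesis
    using e by (simp add: scaleR_conv_of_real field_simps)
qed

lemma integrable_scaled_gauss:
  assumes "e \<noteq> 0"
  shows "integrable lborel (\<lambda>x. gauss (e *\<^sub>R x))"
  using integrable_lborel_affine_iff[of gauss e 0] assms by simp

section \<open>Gaussian regularization and Plancherel's theorem\<close>

text \<open>The squared modulus is the product of the transforms of G and of the reflected conjugate
  \<open>H\<close>. Two uses of the multiplication formula carry the Gaussian factor to the other
  side, where it becomes an averaging kernel at scale e.\<close>

lemma integral_fourier_gauss:
  fixes G :: "'a::euclidean_space \<Rightarrow> complex"
  assumes G: "integrable lborel G" and e: "e \<noteq> 0"
  shows "(LINT \<xi>|lborel. of_real ((norm (fourier G \<xi>))\<^sup>2) * gauss (e *\<^sub>R \<xi>)) =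
    (LINT y|lborel. G y * (LINT w|lborel. cnj (G (y - e *\<^sub>R w)) * gauss w))"
proof -
  have [measurable]: "G \<in> borel_measurable borel"
    using G by (auto dest: borel_measurable_integrable)
  define H where "H = (\<lambda>z. cnj (G (- z)))"
  have [measurable]: "H \<in> borel_measurable borel" by (simp add: H_def)
  have H: "integrable lborel H"
    using integrable_lborel_affine_iff[of G "-1" 0] G by (simp add: H_def)
  \<comment> \<open>A transform is bounded by an L1 norm but need not be integrable; the Gaussian
    factor provides the integrability that the multiplication formula asks for.\<close>
  have bounded: "integrable lborel (\<lambda>\<xi>. fourier F \<xi> * gauss (e *\<^sub>R \<xi>))" 
    if "F \<in> borel_measurable borel" for F :: "'a \<Rightarrow> complex"
  proof (rule Bochner_Integration.integrable_bound)
    show "integrable lborel (\<lambda>\<xi>. of_real (LINT y|lborel. norm (F y)) * gauss (e *\<^sub>R \<xi>) :: complex)"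
      by (intro integrable_mult_right integrable_scaled_gauss e)
    show "AE \<xi> in lborel. norm (fourier F \<xi> * gauss (e *\<^sub>R \<xi>))
        \<le> norm (of_real (LINT y|lborel. norm (F y)) * gauss (e *\<^sub>R \<xi>) :: complex)"
      by (auto simp: norm_mult integral_nonneg_AE intro!: mult_right_mono norm_fourier_le)
    show "(\<lambda>\<xi>. fourier F \<xi> * gauss (e *\<^sub>R \<xi>)) \<in> borel_measurable lborel"
      using that by measurable
  qed
  have "(LINT \<xi>|lborel. of_real ((norm (fourier G \<xi>))\<^sup>2) * gauss (e *\<^sub>R \<xi>)) =
      (LINT \<xi>|lborel. fourier G \<xi> * (fourier H \<xi> * gauss (e *\<^sub>R \<xi>)))"
    unfolding complex_norm_square by (simp add: cnj_fourier H_def mult.assoc)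
  also have "\<dots> = (LINT y|lborel. G y * fourier (\<lambda>\<xi>. fourier H \<xi> * gauss (e *\<^sub>R \<xi>)) y)"
    by (intro integral_mult_fourier bounded G) measurable
  also have "\<dots> = (LINT y|lborel. G y * (LINT w|lborel. cnj (G (y - e *\<^sub>R w)) * gauss w))"
  proof (intro Bochner_Integration.integral_cong refl arg_cong2[where f = "(*)"])
    fix y
    have "fourier (\<lambda>\<xi>. fourier H \<xi> * gauss (e *\<^sub>R \<xi>)) y =
        (LINT \<xi>|lborel. fourier H \<xi> * (gauss (e *\<^sub>R \<xi>) * wave (y \<bullet> \<xi>)))"
      by (simp add: fourier_def[of _ y] inner_commute mult.assoc)
    also have "\<dots> = (LINT z|lborel. H z * fourier (\<lambda>\<xi>. gauss (e *\<^sub>R \<xi>) * wave (y \<bullet> \<xi>)) z)"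
      using e by (intro integral_mult_fourier H integrable_mult_wave integrable_scaled_gauss) auto
    also have "\<dots> = (LINT z|lborel. of_real (inverse (\<bar>e\<bar> ^ DIM('a))) * (H z * gauss (inverse e *\<^sub>R (y + z))))"
      using e by (simp add: fourier_scaled_gauss ac_simps)
    also have "\<dots> = of_real (inverse (\<bar>e\<bar> ^ DIM('a))) * (LINT z|lborel. H z * gauss (inverse e *\<^sub>R (y + z)))"
      by simp
    \<comment> \<open>With z = -y + e w the argument of the Gaussian becomes w, and the Jacobian
      cancels the factor e^(-d).\<close>
    also have "(LINT z|lborel. H z * gauss (inverse e *\<^sub>R (y + z))) =
        \<bar>e\<bar> ^ DIM('a) *\<^sub>R (LINT w|lborel. H (- y + e *\<^sub>R w) * gauss (inverse e *\<^sub>R (y + (- y + e *\<^sub>R w))))"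
      by (rule integral_lborel_affine) (use e in auto)
    finally show "fourier (\<lambda>\<xi>. fourier H \<xi> * gauss (e *\<^sub>R \<xi>)) y =
        (LINT w|lborel. cnj (G (y - e *\<^sub>R w)) * gauss w)"
      using e by (simp add: H_def scaleR_conv_of_real flip: of_real_mult mult.assoc)
  qed
  finally show ?thesis .
qed

lemma norm_gauss: "norm (gauss x) = exp (- (pi * (norm x)\<^sup>2))"
  unfolding gauss_def norm_of_real by simp

text \<open>Nonnegative integrals allow the statement before the transform is known to be square
  integrable. In the regularized identity the side of G converges by dominated convergence and the
  side of the transform by monotone convergence.\<close>

lemma plancherel:
  fixes G :: "'a::euclidean_space \<Rightarrow> complex"
  assumes int: "integrable lborel G" and cont: "continuous_on UNIV G"
    and bdd: "\<And>x. norm (G x) \<le> M"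
  shows "(\<integral>\<^sup>+\<xi>. ennreal ((norm (fourier G \<xi>))\<^sup>2) \<partial>lborel) = (\<integral>\<^sup>+y. ennreal ((norm (G y))\<^sup>2) \<partial>lborel)"
proof -
  define e where "e n = inverse (real (Suc n))" for n
  have e: "e n > 0" "e \<longlonglongrightarrow> 0" "decseq e" for n
    using LIMSEQ_inverse_real_of_nat unfolding e_def by (auto intro!: decseq_SucI simp: field_simps)
  have M: "M \<ge> 0" using bdd[of 0] norm_ge_zero order_trans by blast
  have [measurable]: "G \<in> borel_measurable borel"
    using int by (auto dest: borel_measurable_integrable)
  define I where "I n = (LINT \<xi>|lborel. of_real ((norm (fourier G \<xi>))\<^sup>2) * gauss (e n *\<^sub>R \<xi>))" for n
  let ?J = "\<lambda>n y. LINT w|lborel. cnj (G (y - e n *\<^sub>R w)) * gauss w"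
  \<comment> \<open>Continuity of G gives the pointwise limit, boundedness of G the dominating
    function, and the total mass 1 of the Gaussian the value of the limit.\<close>
  have J: "(\<lambda>n. ?J n y) \<longlonglongrightarrow> cnj (G y)" for y
  proof -
    have "(\<lambda>n. ?J n y) \<longlonglongrightarrow> (LINT w|(lborel :: 'a measure). cnj (G y) * gauss w)"
    proof (rule integral_dominated_convergence)
      show "integrable lborel (\<lambda>w. M * norm (gauss w :: complex))"
        by (intro integrable_mult_right integrable_norm integrable_gauss)
      show "AE w in lborel. (\<lambda>n. cnj (G (y - e n *\<^sub>R w)) * gauss w) \<longlonglongrightarrow> cnj (G y) * gauss w"
      proof (intro AE_I2 tendsto_mult tendsto_const tendsto_cnj)
        fix w
        have "(\<lambda>n. y - e n *\<^sub>R w) \<longlonglongrightarrow> y - 0 *\<^sub>R w"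
          by (intro tendsto_intros e)
        then show "(\<lambda>n. G (y - e n *\<^sub>R w)) \<longlonglongrightarrow> G y"
          using cont by (auto simp: continuous_on_eq_continuous_at intro: isCont_tendsto_compose)
      qed
      show "AE w in lborel. norm (cnj (G (y - e n *\<^sub>R w)) * gauss w) \<le> M * norm (gauss w)" for n
        by (auto simp: norm_mult intro!: mult_right_mono bdd)
    qed measurable
    then show ?thesis by (simp add: integral_gauss)
  qed
  \<comment> \<open>The inner averages are bounded by a constant \<open>C\<close> uniformly in n and
    y, so integrability of G alone dominates.\<close>
  have "(\<lambda>n. LINT y|lborel. G y * ?J n y) \<longlonglongrightarrow> (LINT y|lborel. G y * cnj (G y))"
  proof (rule integral_dominated_convergence)
    define C where "C = (LINT w|(lborel :: 'a measure). M * norm (gauss w :: complex))"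
    show "integrable lborel (\<lambda>y. norm (G y) * C)"
      using int by simp
    show "AE y in lborel. (\<lambda>n. G y * ?J n y) \<longlonglongrightarrow> G y * cnj (G y)"
      by (intro AE_I2 tendsto_mult tendsto_const J)
    show "AE y in lborel. norm (G y * ?J n y) \<le> norm (G y) * C" for n
    proof (rule AE_I2)
      fix y
      have dom: "integrable lborel (\<lambda>w::'a. M * norm (gauss w :: complex))"
        by (intro integrable_mult_right integrable_norm integrable_gauss)
      have bound: "norm (cnj (G (y - e n *\<^sub>R w)) * gauss w) \<le> M * norm (gauss w)" for w
        by (auto simp: norm_mult intro!: mult_right_mono bdd)
      have "integrable lborel (\<lambda>w. cnj (G (y - e n *\<^sub>R w)) * gauss w)"
        by (rule Bochner_Integration.integrable_bound[OF dom])
           (use bound M in \<open>auto simp: abs_mult\<close>)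
      then have "norm (?J n y) \<le> C"
        unfolding C_def by (rule Bochner_Integration.integral_norm_bound_integral[OF _ dom bound])
      then show "norm (G y * ?J n y) \<le> norm (G y) * C"
        by (simp add: norm_mult mult_left_mono)
    qed
  qed measurable
  moreover have "I n = (LINT y|lborel. G y * ?J n y)" for n
    unfolding I_def by (rule integral_fourier_gauss[OF int]) (use e(1)[of n] in auto)
  ultimately have "I \<longlonglongrightarrow> (LINT y|lborel. of_real ((norm (G y))\<^sup>2))"
    unfolding complex_norm_square by presburger
  then have lim: "(\<lambda>n. ennreal (Re (I n))) \<longlonglongrightarrow> ennreal (LINT y|lborel. (norm (G y))\<^sup>2)"
    unfolding integral_complex_of_real by (intro tendsto_ennrealI) (auto dest: tendsto_Re)
  \<comment> \<open>A bounded integrable function is square integrable; this identifies the limit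
    with a nonnegative integral.\<close>
  have sq: "integrable lborel (\<lambda>y. (norm (G y))\<^sup>2)"
    by (rule Bochner_Integration.integrable_bound[where f = "\<lambda>y. M * norm (G y)"])
       (use int M in \<open>auto simp: power2_eq_square intro!: mult_right_mono bdd\<close>)
  let ?g = "\<lambda>n \<xi>. (norm (fourier G \<xi>))\<^sup>2 * exp (- (pi * (norm (e n *\<^sub>R \<xi>))\<^sup>2))"
  have g_int: "integrable lborel (?g n)" for n
  proof (rule Bochner_Integration.integrable_bound)
    show "integrable lborel (\<lambda>\<xi>::'a. (LINT y|lborel. norm (G y))\<^sup>2 * norm (gauss (e n *\<^sub>R \<xi>) :: complex))"
      using e(1)[of n] by (intro integrable_mult_right integrable_norm integrable_scaled_gauss) auto
    show "AE \<xi> in lborel. norm (?g n \<xi>) \<le> norm ((LINT y|lborel. norm (G y))\<^sup>2 * norm (gauss (e n *\<^sub>R \<xi>)))"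
      by (auto simp: norm_gauss abs_mult intro!: mult_right_mono power_mono norm_fourier_le)
  qed measurable
  have I: "ennreal (Re (I n)) = (\<integral>\<^sup>+\<xi>. ennreal (?g n \<xi>) \<partial>lborel)" for n
  proof -
    have "I n = of_real (LINT \<xi>|lborel. ?g n \<xi>)"
      unfolding I_def gauss_def of_real_mult[symmetric] by (rule integral_complex_of_real)
    then show ?thesis
      by (subst nn_integral_eq_integral[OF g_int]) auto
  qed
  \<comment> \<open>As \<open>e n\<close> decreases to 0 the Gaussian factors increase to 1, so
    monotone convergence applies.\<close>
  have "(\<lambda>n. \<integral>\<^sup>+\<xi>. ennreal (?g n \<xi>) \<partial>lborel) \<longlonglongrightarrow> (\<integral>\<^sup>+\<xi>. ennreal ((norm (fourier G \<xi>))\<^sup>2) \<partial>lborel)"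
  proof (rule nn_integral_LIMSEQ)
    show "incseq (\<lambda>n \<xi>. ennreal (?g n \<xi>))"
      using e(1,3) unfolding incseq_def decseq_def le_fun_def
      by (auto intro!: ennreal_leI mult_left_mono mult_right_mono power_mono simp: less_imp_le)
    show "(\<lambda>n. ennreal (?g n \<xi>)) \<longlonglongrightarrow> ennreal ((norm (fourier G \<xi>))\<^sup>2)" for \<xi>
    proof (rule tendsto_ennrealI)
      have "(\<lambda>n. ?g n \<xi>) \<longlonglongrightarrow> (norm (fourier G \<xi>))\<^sup>2 * exp (- (pi * (norm (0 *\<^sub>R \<xi>))\<^sup>2))"
        by (intro tendsto_intros e)
      then show "(\<lambda>n. ?g n \<xi>) \<longlonglongrightarrow> (norm (fourier G \<xi>))\<^sup>2"
        by simp
    qed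
  qed measurable
  with lim have "(\<integral>\<^sup>+\<xi>. ennreal ((norm (fourier G \<xi>))\<^sup>2) \<partial>lborel) = ennreal (LINT y|lborel. (norm (G y))\<^sup>2)"
    unfolding I by (rule LIMSEQ_unique[symmetric])
  also have "\<dots> = (\<integral>\<^sup>+y. ennreal ((norm (G y))\<^sup>2) \<partial>lborel)"
    by (rule nn_integral_eq_integral[symmetric]) (use sq in auto)
  finally show ?thesis .
qed

section \<open>The sphere measure and polar coordinates\<close>

lemma emeasure_unit_ball:
  "emeasure lborel (ball (0::'a::euclidean_space) 1) = ennreal (unit_ball_vol (DIM('a)))"
  by (simp add: emeasure_ball)

lemma prob_space_uniform_ball: "prob_space (uniform_measure lborel (ball (0::'a::euclidean_space) 1))"
  by (rule prob_space_uniform_measure) (simp_all add: emeasure_unit_ball less_imp_neq[symmetric])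

text \<open>The factor d r^(d-1) occurs in both numerator and denominator of the normalization and
  cancels. The radial projection maps the ball minus the origin into the sphere, and the origin is a
  null set.\<close>

lemma sphere_measure_eq_distr:
  assumes r: "r > 0"
  shows "(sphere_measure r :: (real ^ 'd) measure) =
    distr (uniform_measure lborel (ball 0 1)) borel (\<lambda>y. (r / norm y) *\<^sub>R y)"
proof (rule measure_eqI)
  fix A :: "(real ^ 'd) set" assume "A \<in> sets (sphere_measure r)"
  then have [measurable]: "A \<in> sets borel" by simp
  let ?B = "ball 0 1 :: (real ^ 'd) set" and ?p = "\<lambda>y::real ^ 'd. (r / norm y) *\<^sub>R y"
  have [measurable]: "?B \<in> sets borel" "sphere (0 :: real ^ 'd) r \<in> sets borel" by simp_all
  have p: "?p \<in> borel_measurable borel" by measurable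
  have pre: "{y \<in> ?B. ?p y \<in> C} \<in> sets borel" if "C \<in> sets borel" for C
  proof -
    have "{y \<in> ?B. ?p y \<in> C} = ?B \<inter> ?p -` C" by auto
    then show ?thesis using measurable_sets_borel[OF p that] by simp
  qed
  let ?c = "real CARD('d) * r ^ (CARD('d) - 1)"
  have M: "sets (surface_measure r :: (real ^ 'd) measure) = sets borel"
    by (simp add: surface_measure_def)
  have c: "?c > 0" using r by simp
  have 0: "emeasure lborel {y \<in> ?B. ?p y \<in> sphere 0 r \<inter> A} = emeasure lborel {y \<in> ?B. ?p y \<in> A}"
  proof (rule emeasure_eq_AE)
    show "AE y in lborel. y \<in> {y \<in> ?B. ?p y \<in> sphere 0 r \<inter> A} \<longleftrightarrow> y \<in> {y \<in> ?B. ?p y \<in> A}"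
      using AE_lborel_singleton[of "0 :: real ^ 'd"] by eventually_elim (use r in auto)
  qed (simp_all add: pre)
  have 1: "emeasure lborel {y \<in> ?B. ?p y \<in> sphere 0 r} = emeasure lborel ?B"
  proof (rule emeasure_eq_AE)
    show "AE y in lborel. y \<in> {y \<in> ?B. ?p y \<in> sphere 0 r} \<longleftrightarrow> y \<in> ?B"
      using AE_lborel_singleton[of "0 :: real ^ 'd"] by eventually_elim (use r in auto)
  qed (simp_all add: pre)
  have "emeasure (sphere_measure r) A =
      (ennreal ?c * emeasure lborel {y \<in> ?B. ?p y \<in> A}) / (ennreal ?c * emeasure lborel ?B)"
  proof -
    have e: "emeasure (surface_measure r) C = ennreal ?c * emeasure lborel {y \<in> ?B. ?p y \<in> C}"
      if "C \<in> sets borel" for C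
      using that by (rule emeasure_surface_measure)
    have "emeasure (sphere_measure r) A =
        emeasure (surface_measure r) (sphere 0 r \<inter> A) /
          emeasure (surface_measure r) (sphere (0 :: real ^ 'd) r)"
      unfolding sphere_measure_def by (rule emeasure_uniform_measure) (simp_all add: M)
    moreover have "sphere 0 r \<inter> A \<in> sets borel" "sphere (0 :: real ^ 'd) r \<in> sets borel"
      by measurable
    ultimately show ?thesis
      by (simp only: e 0 1)
  qed
  also have "\<dots> = emeasure lborel {y \<in> ?B. ?p y \<in> A} / emeasure lborel ?B"
    unfolding mult.commute[of "ennreal ?c"] by (rule divide_mult_eq) (use c r in auto)
  also have "\<dots> = emeasure (distr (uniform_measure lborel ?B) borel ?p) A"
    by (subst emeasure_distr) (auto simp: vimage_def Int_def)
  finally show "emeasure (sphere_measure r) A = emeasure (distr (uniform_measure lborel ?B) borel ?p) A" .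
qed simp

lemma prob_space_sphere_measure:
  "r > 0 \<Longrightarrow> prob_space (sphere_measure r :: (real ^ 'd) measure)"
  unfolding sphere_measure_eq_distr by (intro prob_space.prob_space_distr prob_space_uniform_ball) measurable

lemma sphere_measure_scale:
  assumes r: "r > 0"
  shows "(sphere_measure r :: (real ^ 'd) measure) = distr (sphere_measure 1) borel ((*\<^sub>R) r)"
  using r by (simp add: sphere_measure_eq_distr distr_distr comp_def)

lemma AE_norm_sphere_measure: "AE \<theta> in (sphere_measure 1 :: (real ^ 'd) measure). norm \<theta> = 1"
proof -
  have "AE y in uniform_measure lborel (ball (0 :: real ^ 'd) 1). norm ((1 / norm y) *\<^sub>R y) = 1"
    by (rule AE_uniform_measureI)
       (use AE_lborel_singleton[of "0 :: real ^ 'd"] in \<open>auto elim!: eventually_mono\<close>)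
  then show ?thesis
    by (subst sphere_measure_eq_distr, simp, subst AE_distr_iff) auto
qed

text \<open>With \<open>\<mu>\<close> the image of Lebesgue measure \<open>\<lambda>\<close> under \<open>T\<close>, Tonelli's theorem and translation invariance
  give \<open>\<mu>(A) \<lambda>(B) = \<lambda>(A) \<mu>(B)\<close>; the unit ball \<open>B\<close> is \<open>T\<close>-invariant, so the constant is \<open>1\<close>. The
  library's \<open>measure_orthogonal_image\<close> needs a well-ordered index type.\<close>
lemma distr_lborel_orthogonal:
  fixes T :: "'a::euclidean_space \<Rightarrow> 'a"
  assumes T: "orthogonal_transformation T"
  shows "distr lborel borel T = lborel"
proof (rule measure_eqI)
  have lin: "linear T" using T by (rule orthogonal_transformation_linear)
  then have [measurable]: "T \<in> borel_measurable borel"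
    by (intro borel_measurable_continuous_onI linear_continuous_on) (simp add: linear_conv_bounded_linear)
  have norm: "norm (T x) = norm x" for x
    using T by (rule orthogonal_transformation_norm)
  fix A assume "A \<in> sets (distr lborel borel T)"
  then have [measurable]: "A \<in> sets borel" by simp
  let ?B = "ball 0 1 :: 'a set"
  have [measurable]: "?B \<in> sets borel" by simp
  have shift: "(\<integral>\<^sup>+x. f x \<partial>lborel) = (\<integral>\<^sup>+x. f (t + x) \<partial>lborel)"
    if "f \<in> borel_measurable borel" for f :: "'a \<Rightarrow> ennreal" and t
    using nn_integral_lborel_affine[OF that, of 1 t] by simp
  have reflect: "(\<integral>\<^sup>+x. f x \<partial>lborel) = (\<integral>\<^sup>+x. f (t - x) \<partial>lborel)"
    if "f \<in> borel_measurable borel" for f :: "'a \<Rightarrow> ennreal" and t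
    using nn_integral_lborel_affine[OF that, of "-1" t] by simp
  let ?\<mu> = "\<lambda>A. \<integral>\<^sup>+x. indicator A (T x) \<partial>lborel"
  have "?\<mu> A * emeasure lborel ?B =
      (\<integral>\<^sup>+x. \<integral>\<^sup>+y. indicator A (T x) * indicator ?B y \<partial>lborel \<partial>lborel)"
    by (subst nn_integral_cmult) (simp_all add: nn_integral_multc)
  also have "\<dots> = (\<integral>\<^sup>+x. \<integral>\<^sup>+y. indicator A (T x) * indicator ?B (T x + y) \<partial>lborel \<partial>lborel)"
    by (intro nn_integral_cong shift) measurable
  also have "\<dots> = (\<integral>\<^sup>+y. \<integral>\<^sup>+x. indicator A (T x) * indicator ?B (T x + y) \<partial>lborel \<partial>lborel)"
    by (rule lborel_pair.Fubini') measurable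
  \<comment> \<open>For fixed y = T z, translating x by -z moves the shift from the indicator of the
    ball to that of A.\<close>
  also have "\<dots> = (\<integral>\<^sup>+y. \<integral>\<^sup>+x. indicator A (T x - y) * indicator ?B (T x) \<partial>lborel \<partial>lborel)"
  proof (rule nn_integral_cong)
    fix y
    obtain z where z: "T z = y"
      using orthogonal_transformation_surj[OF T] by (metis surjD)
    show "(\<integral>\<^sup>+x. indicator A (T x) * indicator ?B (T x + y) \<partial>lborel) =
        (\<integral>\<^sup>+x. indicator A (T x - y) * indicator ?B (T x) \<partial>lborel)"
      by (subst shift[of _ "- z"]) (auto simp: linear_add[OF lin] linear_diff[OF lin] z)
  qed
  also have "\<dots> = (\<integral>\<^sup>+x. \<integral>\<^sup>+y. indicator A (T x - y) * indicator ?B (T x) \<partial>lborel \<partial>lborel)"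
    by (rule lborel_pair.Fubini') measurable
  also have "\<dots> = (\<integral>\<^sup>+x. \<integral>\<^sup>+y. indicator A y * indicator ?B (T x) \<partial>lborel \<partial>lborel)"
    by (intro nn_integral_cong reflect[symmetric]) measurable
  also have "\<dots> = emeasure lborel A * ?\<mu> ?B"
    by (subst nn_integral_multc) (simp_all add: nn_integral_cmult)
  also have "?\<mu> ?B = emeasure lborel ?B"
  proof -
    have "(\<lambda>x. indicator ?B (T x)) = (indicator ?B :: 'a \<Rightarrow> ennreal)"
      by (simp add: fun_eq_iff indicator_def norm)
    then show ?thesis by simp
  qed
  finally have "?\<mu> A = emeasure lborel A"
    using ennreal_mult_divide_eq[of "emeasure lborel ?B"]
    by (metis emeasure_unit_ball ennreal_eq_0_iff ennreal_neq_top not_le of_nat_0_le_iff unit_ball_vol_pos)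
  then show "emeasure (distr lborel borel T) A = emeasure lborel A"
    by (subst nn_integral_indicator[symmetric], simp, subst nn_integral_distr) simp_all
qed simp

text \<open>An orthogonal map preserves the uniform measure on the ball and commutes with the radial
  projection.\<close>

lemma distr_sphere_measure_orthogonal:
  fixes T :: "real ^ 'd \<Rightarrow> real ^ 'd"
  assumes T: "orthogonal_transformation T"
  shows "distr (sphere_measure 1) borel T = sphere_measure 1"
proof -
  have lin: "linear T" using T by (rule orthogonal_transformation_linear)
  then have [measurable]: "T \<in> borel_measurable borel"
    by (intro borel_measurable_continuous_onI linear_continuous_on) (simp add: linear_conv_bounded_linear)
  have norm: "norm (T x) = norm x" for x
    using T by (rule orthogonal_transformation_norm)
  let ?U = "uniform_measure lborel (ball (0 :: real ^ 'd) 1)"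
  have U: "distr ?U borel T = ?U"
  proof (rule measure_eqI)
    fix A assume "A \<in> sets (distr ?U borel T)"
    then have [measurable]: "A \<in> sets borel" by simp
    have "emeasure lborel (ball 0 1 \<inter> T -` A) = emeasure (distr lborel borel T) (ball 0 1 \<inter> A)"
      by (subst emeasure_distr) (auto simp: norm intro!: arg_cong[where f = "emeasure lborel"])
    then show "emeasure (distr ?U borel T) A = emeasure ?U A"
      using measurable_sets_borel[of T borel A]
      by (simp add: emeasure_distr distr_lborel_orthogonal[OF T] Int_commute)
  qed simp
  have "distr (sphere_measure 1) borel T = distr ?U borel (\<lambda>y. (1 / norm (T y)) *\<^sub>R T y)"
    by (simp add: sphere_measure_eq_distr distr_distr comp_def norm linear_scale[OF lin])
  also have "\<dots> = distr (distr ?U borel T) borel (\<lambda>y. (1 / norm y) *\<^sub>R y)"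
    by (simp add: distr_distr comp_def)
  also have "\<dots> = sphere_measure 1"
    unfolding U by (simp add: sphere_measure_eq_distr)
  finally show ?thesis .
qed

section \<open>The radial measure and integration in polar coordinates\<close>

text \<open>For positive n, the image of n-dimensional Lebesgue measure under the norm;
  \<open>real n * unit_ball_vol n\<close> is the area of the unit sphere.\<close>

definition radial_measure :: "nat \<Rightarrow> real measure" where
  "radial_measure n =
     density lborel (\<lambda>t. ennreal (real n * unit_ball_vol n * t ^ (n - 1)) * indicator {0<..} t)"

lemma sets_radial_measure [simp, measurable_cong]: "sets (radial_measure n) = sets borel"
  by (simp add: radial_measure_def)

lemma sigma_finite_radial_measure: "sigma_finite_measure (radial_measure n)"
  unfolding radial_measure_def
  by (subst sigma_finite_measure.sigma_finite_iff_density_finite[OF sigma_finite_lborel])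
     (auto simp: ennreal_mult_eq_top_iff indicator_def)

text \<open>The antiderivative \<open>- (a ^ n) / s ^ n\<close> vanishes at infinity. In polar
  coordinates, with a = \<open>norm z\<close>, this integral removes the auxiliary radial
  variable.\<close>

lemma nn_integral_tail_power:
  assumes a: "a > 0" and n: "n > 0"
  shows "(\<integral>\<^sup>+s. ennreal (real n * a ^ n / s ^ Suc n) * indicator {a<..} s \<partial>lborel) = 1"
proof -
  have "(\<integral>\<^sup>+s. ennreal (real n * a ^ n / s ^ Suc n) * indicator {a<..} s \<partial>lborel) =
      (\<integral>\<^sup>+s. ennreal (real n * a ^ n / s ^ Suc n) * indicator {a..} s \<partial>lborel)"
    by (rule nn_integral_cong_AE)
       (use AE_lborel_singleton[of a] in \<open>auto elim!: eventually_mono simp: indicator_def\<close>)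
  also have "\<dots> = ennreal (0 - (- (a ^ n) / a ^ n))"
  proof (rule nn_integral_FTC_atLeast[where F = "\<lambda>s. - (a ^ n) / s ^ n"])
    fix s assume s: "a \<le> s"
    have "((\<lambda>s. - (a ^ n) / s ^ n) has_real_derivative a ^ n * (real n * s ^ (n - 1)) / (s ^ n * s ^ n)) (at s)"
      using s a by (auto intro!: derivative_eq_intros)
    moreover have "a ^ n * (real n * s ^ (n - 1)) / (s ^ n * s ^ n) = real n * a ^ n / s ^ Suc n"
      using s a n by (cases n) (auto simp: field_simps)
    ultimately show "((\<lambda>s. - (a ^ n) / s ^ n) has_real_derivative real n * a ^ n / s ^ Suc n) (at s)"
      by simp
    show "0 \<le> real n * a ^ n / s ^ Suc n" using s a by auto
  next
    show "((\<lambda>s. - (a ^ n) / s ^ n) \<longlongrightarrow> 0) at_top"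
      using n by (intro real_tendsto_divide_at_top[OF tendsto_const] filterlim_pow_at_top filterlim_ident) auto
  qed measurable
  also have "\<dots> = 1" using a by simp
  finally show ?thesis .
qed

text \<open>Provides measurability of \<open>indicator {norm z<..} s\<close>, whose interval varies
  with z.\<close>

lemma pred_in_greaterThan [measurable (raw)]:
  fixes f g :: "'a \<Rightarrow> real"
  assumes [measurable]: "f \<in> borel_measurable M" "g \<in> borel_measurable M"
  shows "Measurable.pred M (\<lambda>x. g x \<in> {f x<..})"
  unfolding greaterThan_iff by measurable

text \<open>Only Tonelli's theorem and dilations are used: \<open>sphere_measure 1\<close> is an average over the unit
  ball, and after exchanging the integrals the substitutions \<open>t = s |y|\<close> and \<open>z = s y\<close> decouple the
  radial integral.\<close>
lemma nn_integral_polar: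
  fixes F :: "real ^ 'd \<Rightarrow> ennreal"
  assumes [measurable]: "F \<in> borel_measurable borel"
  shows "(\<integral>\<^sup>+y. F y \<partial>lborel) =
    (\<integral>\<^sup>+t. \<integral>\<^sup>+\<theta>. F (t *\<^sub>R \<theta>) \<partial>sphere_measure 1 \<partial>radial_measure CARD('d))"
proof -
  let ?n = "CARD('d)" and ?B = "ball 0 1 :: (real ^ 'd) set"
  let ?V = "unit_ball_vol (real ?n)"
  have n: "?n > 0" by simp
  have V: "?V > 0" by (rule unit_ball_vol_pos) simp
  have [measurable]: "?B \<in> sets borel" by simp
  have "(\<integral>\<^sup>+t. \<integral>\<^sup>+\<theta>. F (t *\<^sub>R \<theta>) \<partial>sphere_measure 1 \<partial>radial_measure ?n) =
      (\<integral>\<^sup>+t. ennreal (real ?n * ?V * t ^ (?n - 1)) * indicator {0<..} t *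
        ((\<integral>\<^sup>+y. F ((t / norm y) *\<^sub>R y) * indicator ?B y \<partial>lborel) / ennreal ?V) \<partial>lborel)"
    unfolding radial_measure_def
    by (subst nn_integral_density) (simp_all add: sphere_measure_eq_distr nn_integral_distr
         nn_integral_uniform_measure emeasure_unit_ball)
  \<comment> \<open>The ball volume in the radial density cancels the normalization of the uniform
    measure.\<close>
  also have "\<dots> = (\<integral>\<^sup>+t. \<integral>\<^sup>+y. ennreal (real ?n * t ^ (?n - 1)) * indicator {0<..} t *
        (F ((t / norm y) *\<^sub>R y) * indicator ?B y) \<partial>lborel \<partial>lborel)"
  proof (rule nn_integral_cong)
    fix t :: real
    have *: "ennreal (real ?n * ?V * t ^ (?n - 1)) * indicator {0<..} t * (X / ennreal ?V) =
        ennreal (real ?n * t ^ (?n - 1)) * indicator {0<..} t * X" for X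
    proof (cases "t > 0")
      case True
      have "ennreal (real ?n * ?V * t ^ (?n - 1)) = ennreal (real ?n * t ^ (?n - 1)) * ennreal ?V"
        using True V by (simp flip: ennreal_mult add: ac_simps)
      then have "ennreal (real ?n * ?V * t ^ (?n - 1)) * (X / ennreal ?V) =
          ennreal (real ?n * t ^ (?n - 1)) * (ennreal ?V * (X / ennreal ?V))"
        by (simp add: ac_simps)
      also have "ennreal ?V * (X / ennreal ?V) = X * ennreal ?V / ennreal ?V"
        by (simp add: ennreal_times_divide mult.commute)
      also have "\<dots> = X"
        using V by (intro ennreal_mult_divide_eq) (auto simp del: unit_ball_vol_pos simp: less_le)
      finally show ?thesis using True by simp
    qed simp
    show "ennreal (real ?n * ?V * t ^ (?n - 1)) * indicator {0<..} t *
          ((\<integral>\<^sup>+y. F ((t / norm y) *\<^sub>R y) * indicator ?B y \<partial>lborel) / ennreal ?V) =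
        (\<integral>\<^sup>+y. ennreal (real ?n * t ^ (?n - 1)) * indicator {0<..} t *
          (F ((t / norm y) *\<^sub>R y) * indicator ?B y) \<partial>lborel)"
      unfolding * by (rule nn_integral_cmult[symmetric]) measurable
  qed
  also have "\<dots> = (\<integral>\<^sup>+y. \<integral>\<^sup>+t. ennreal (real ?n * t ^ (?n - 1)) * indicator {0<..} t *
        (F ((t / norm y) *\<^sub>R y) * indicator ?B y) \<partial>lborel \<partial>lborel)"
    by (rule lborel_pair.Fubini') measurable
  \<comment> \<open>For y \<noteq> 0 substitute t = s |y|; the Jacobian |y| raises the power of |y|
    from d - 1 to d.\<close>
  also have "\<dots> = (\<integral>\<^sup>+y. \<integral>\<^sup>+s. ennreal (real ?n * norm y ^ ?n * s ^ (?n - 1)) * indicator {0<..} s *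
        (F (s *\<^sub>R y) * indicator ?B y) \<partial>lborel \<partial>lborel)"
  proof (rule nn_integral_cong_AE)
    show "AE y in lborel. (\<integral>\<^sup>+t. ennreal (real ?n * t ^ (?n - 1)) * indicator {0<..} t *
          (F ((t / norm y) *\<^sub>R y) * indicator ?B y) \<partial>lborel) =
        (\<integral>\<^sup>+s. ennreal (real ?n * norm y ^ ?n * s ^ (?n - 1)) * indicator {0<..} s *
          (F (s *\<^sub>R y) * indicator ?B y) \<partial>lborel)"
      using AE_lborel_singleton[of "0 :: real ^ 'd"]
    proof eventually_elim
      fix y :: "real ^ 'd" assume y: "y \<noteq> 0"
      have p: "norm y * norm y ^ (?n - 1) = norm y ^ ?n"
        using n by (cases ?n) auto
      have "(\<integral>\<^sup>+t. ennreal (real ?n * t ^ (?n - 1)) * indicator {0<..} t *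
          (F ((t / norm y) *\<^sub>R y) * indicator ?B y) \<partial>lborel) =
         ennreal \<bar>norm y\<bar> * (\<integral>\<^sup>+s. ennreal (real ?n * (0 + norm y * s) ^ (?n - 1)) * indicator {0<..} (0 + norm y * s) *
          (F (((0 + norm y * s) / norm y) *\<^sub>R y) * indicator ?B y) \<partial>lborel)"
        by (rule nn_integral_real_affine) (use y in auto)
      also have "\<dots> = (\<integral>\<^sup>+s. ennreal \<bar>norm y\<bar> * (ennreal (real ?n * (0 + norm y * s) ^ (?n - 1)) * indicator {0<..} (0 + norm y * s) *
          (F (((0 + norm y * s) / norm y) *\<^sub>R y) * indicator ?B y)) \<partial>lborel)"
        by (rule nn_integral_cmult[symmetric]) measurable
      also have "\<dots> = (\<integral>\<^sup>+s. ennreal (real ?n * norm y ^ ?n * s ^ (?n - 1)) * indicator {0<..} s *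
          (F (s *\<^sub>R y) * indicator ?B y) \<partial>lborel)"
      proof (rule nn_integral_cong)
        fix s
        have "ennreal \<bar>norm y\<bar> * ennreal (real ?n * (0 + norm y * s) ^ (?n - 1)) =
            ennreal (real ?n * norm y ^ ?n * s ^ (?n - 1))" 
          unfolding p[symmetric] by (simp add: power_mult_distrib ac_simps flip: ennreal_mult')
        then show "ennreal \<bar>norm y\<bar> * (ennreal (real ?n * (0 + norm y * s) ^ (?n - 1)) * indicator {0<..} (0 + norm y * s) *
            (F (((0 + norm y * s) / norm y) *\<^sub>R y) * indicator ?B y)) =
          ennreal (real ?n * norm y ^ ?n * s ^ (?n - 1)) * indicator {0<..} s * (F (s *\<^sub>R y) * indicator ?B y)"
          using y by (simp add: zero_less_mult_iff indicator_def mult.assoc[symmetric])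
      qed
      finally show "(\<integral>\<^sup>+t. ennreal (real ?n * t ^ (?n - 1)) * indicator {0<..} t *
          (F ((t / norm y) *\<^sub>R y) * indicator ?B y) \<partial>lborel) =
        (\<integral>\<^sup>+s. ennreal (real ?n * norm y ^ ?n * s ^ (?n - 1)) * indicator {0<..} s *
          (F (s *\<^sub>R y) * indicator ?B y) \<partial>lborel)" .
    qed
  qed
  also have "\<dots> = (\<integral>\<^sup>+s. \<integral>\<^sup>+y. ennreal (real ?n * norm y ^ ?n * s ^ (?n - 1)) * indicator {0<..} s *
        (F (s *\<^sub>R y) * indicator ?B y) \<partial>lborel \<partial>lborel)"
    by (rule lborel_pair.Fubini') measurable
  \<comment> \<open>For s > 0 substitute z = s y, with Jacobian s^d; the condition |y| < 1 becomes
    |z| < s. For s \<le> 0 both integrands vanish.\<close>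
  also have "\<dots> = (\<integral>\<^sup>+s. \<integral>\<^sup>+z. F z * (ennreal (real ?n * norm z ^ ?n / s ^ Suc ?n) * indicator {norm z<..} s) \<partial>lborel \<partial>lborel)"
  proof (rule nn_integral_cong)
    fix s :: real
    show "(\<integral>\<^sup>+y. ennreal (real ?n * norm y ^ ?n * s ^ (?n - 1)) * indicator {0<..} s *
        (F (s *\<^sub>R y) * indicator ?B y) \<partial>lborel) =
      (\<integral>\<^sup>+z. F z * (ennreal (real ?n * norm z ^ ?n / s ^ Suc ?n) * indicator {norm z<..} s) \<partial>lborel)"
    proof (cases "s > 0")
      case True
      have "(\<integral>\<^sup>+z. F z * (ennreal (real ?n * norm z ^ ?n / s ^ Suc ?n) * indicator {norm z<..} s) \<partial>lborel) =
        ennreal (\<bar>s\<bar> ^ DIM(real ^ 'd)) * (\<integral>\<^sup>+y. F (0 + s *\<^sub>R y) * (ennreal (real ?n * norm (0 + s *\<^sub>R y) ^ ?n / s ^ Suc ?n) *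
           indicator {norm (0 + s *\<^sub>R y)<..} s) \<partial>lborel)"
      proof (rule nn_integral_lborel_affine)
        show "s \<noteq> 0" using True by simp
      qed measurable
      also have "\<dots> = (\<integral>\<^sup>+y. ennreal (\<bar>s\<bar> ^ DIM(real ^ 'd)) * (F (0 + s *\<^sub>R y) * (ennreal (real ?n * norm (0 + s *\<^sub>R y) ^ ?n / s ^ Suc ?n) *
           indicator {norm (0 + s *\<^sub>R y)<..} s)) \<partial>lborel)"
        by (rule nn_integral_cmult[symmetric]) measurable
      also have "\<dots> = (\<integral>\<^sup>+y. ennreal (real ?n * norm y ^ ?n * s ^ (?n - 1)) * indicator {0<..} s *
        (F (s *\<^sub>R y) * indicator ?B y) \<partial>lborel)"
      proof (rule nn_integral_cong)
        fix y :: "real ^ 'd"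
        have p: "s ^ ?n = s * s ^ (?n - 1)"
          using n by (cases ?n) auto
        have reorder: "a * (b * (c * d)) = a * c * 1 * (b * d)" for a b c d :: ennreal
          by (simp add: ac_simps)
        have "s ^ ?n * (real ?n * norm (s *\<^sub>R y) ^ ?n / s ^ Suc ?n) = real ?n * norm y ^ ?n * s ^ (?n - 1)"
          using True by (simp add: power_mult_distrib p)
        then have "ennreal (\<bar>s\<bar> ^ ?n) * ennreal (real ?n * norm (s *\<^sub>R y) ^ ?n / s ^ Suc ?n) =
            ennreal (real ?n * norm y ^ ?n * s ^ (?n - 1))"
          using True by (simp flip: ennreal_mult')
        moreover have "indicator {norm (0 + s *\<^sub>R y)<..} s = (indicator ?B y :: ennreal)"
          using True by (auto simp: indicator_def)
        ultimately show "ennreal (\<bar>s\<bar> ^ DIM(real ^ 'd)) * (F (0 + s *\<^sub>R y) * (ennreal (real ?n * norm (0 + s *\<^sub>R y) ^ ?n / s ^ Suc ?n) *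
           indicator {norm (0 + s *\<^sub>R y)<..} s)) =
          ennreal (real ?n * norm y ^ ?n * s ^ (?n - 1)) * indicator {0<..} s * (F (s *\<^sub>R y) * indicator ?B y)"
          using True by (simp only: reorder add_0 inner_real_def DIM_cart DIM_real mult_1_right abs_of_pos indicator_simps greaterThan_iff)
      qed
      finally show ?thesis ..
    next
      case False
      then have "indicator {norm z<..} s = (0::ennreal)" for z :: "real ^ 'd"
        using norm_ge_zero[of z] by (auto simp: indicator_def simp del: norm_ge_zero)
      then show ?thesis using False by simp
    qed
  qed
  also have "\<dots> = (\<integral>\<^sup>+z. \<integral>\<^sup>+s. F z * (ennreal (real ?n * norm z ^ ?n / s ^ Suc ?n) * indicator {norm z<..} s) \<partial>lborel \<partial>lborel)"
    by (rule lborel_pair.Fubini') measurable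
  \<comment> \<open>The weight of F z now integrates over s to 1 for every z \<noteq> 0.\<close>
  also have "\<dots> = (\<integral>\<^sup>+z. F z \<partial>lborel)"
    by (rule nn_integral_cong_AE)
      (use AE_lborel_singleton[of "0 :: real ^ 'd"] in \<open>auto elim!: eventually_mono simp: nn_integral_cmult nn_integral_tail_power simp del: power_Suc\<close>)
  finally show ?thesis ..
qed

text \<open>Testing the polar formula on indicators turns it into an identity of measures, through
  which Bochner integrals can be transferred.\<close>

lemma lborel_eq_distr_polar:
  "(lborel :: (real ^ 'd) measure) =
    distr (radial_measure CARD('d) \<Otimes>\<^sub>M sphere_measure 1) borel (\<lambda>(t, \<theta>). t *\<^sub>R \<theta>)"
proof (rule measure_eqI)
  interpret S: prob_space "sphere_measure 1 :: (real ^ 'd) measure"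
    by (rule prob_space_sphere_measure) simp
  fix A :: "(real ^ 'd) set" assume "A \<in> sets lborel"
  then have [measurable]: "A \<in> sets borel" by simp
  have "emeasure lborel A = (\<integral>\<^sup>+y. indicator A y \<partial>lborel)" by simp
  also have "\<dots> = (\<integral>\<^sup>+t. \<integral>\<^sup>+\<theta>. indicator A (case (t, \<theta>) of (t, \<theta>) \<Rightarrow> t *\<^sub>R \<theta>) \<partial>sphere_measure 1 \<partial>radial_measure CARD('d))"
    by (subst nn_integral_polar) simp_all
  also have "\<dots> = (\<integral>\<^sup>+p. indicator A (case p of (t, \<theta>) \<Rightarrow> t *\<^sub>R \<theta>) \<partial>(radial_measure CARD('d) \<Otimes>\<^sub>M sphere_measure 1))"
    by (rule S.nn_integral_fst) measurable
  also have "\<dots> = (\<integral>\<^sup>+y. indicator A y \<partial>distr (radial_measure CARD('d) \<Otimes>\<^sub>M sphere_measure 1) borel (\<lambda>(t, \<theta>). t *\<^sub>R \<theta>))"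
    by (rule nn_integral_distr[symmetric]) measurable
  finally show "emeasure lborel A =
      emeasure (distr (radial_measure CARD('d) \<Otimes>\<^sub>M sphere_measure 1) borel (\<lambda>(t, \<theta>). t *\<^sub>R \<theta>)) A"
    by simp
qed simp

lemma integral_polar:
  fixes F :: "real ^ 'd \<Rightarrow> 'b::{banach, second_countable_topology}"
  assumes F: "integrable lborel F"
  shows "(LINT y|lborel. F y) = (LINT t|radial_measure CARD('d). LINT \<theta>|sphere_measure 1. F (t *\<^sub>R \<theta>))"
proof -
  interpret S: prob_space "sphere_measure 1 :: (real ^ 'd) measure"
    by (rule prob_space_sphere_measure) simp
  interpret R: sigma_finite_measure "radial_measure CARD('d)"
    by (rule sigma_finite_radial_measure)
  interpret P: pair_sigma_finite "radial_measure CARD('d)" "sphere_measure 1 :: (real ^ 'd) measure" ..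
  let ?P = "radial_measure CARD('d) \<Otimes>\<^sub>M (sphere_measure 1 :: (real ^ 'd) measure)"
  have [measurable]: "F \<in> borel_measurable borel"
    using F by (auto dest: borel_measurable_integrable)
  have "integrable (distr ?P borel (\<lambda>(t, \<theta>). t *\<^sub>R \<theta>)) F"
    using F lborel_eq_distr_polar[where 'd = 'd] by simp
  then have "integrable ?P (\<lambda>p. F (case p of (t, \<theta>) \<Rightarrow> t *\<^sub>R \<theta>))"
    by (subst (asm) integrable_distr_eq) measurable
  from P.integral_fst'[OF this]
  have "(LINT t|radial_measure CARD('d). LINT \<theta>|sphere_measure 1. F (t *\<^sub>R \<theta>)) =
      (LINT p|?P. F (case p of (t, \<theta>) \<Rightarrow> t *\<^sub>R \<theta>))"
    by simp
  also have "\<dots> = (LINT y|distr ?P borel (\<lambda>(t, \<theta>). t *\<^sub>R \<theta>). F y)"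
    by (rule integral_distr[symmetric]) measurable
  finally show ?thesis
    using lborel_eq_distr_polar[where 'd = 'd] by simp
qed

lemma AE_radial_measure_pos: "AE t in radial_measure n. t > 0"
  unfolding radial_measure_def by (subst AE_density) (auto simp: indicator_def)

text \<open>On almost all of the unit sphere the integrand is constant, and the sphere measure has
  total mass 1.\<close>

lemma nn_integral_radial_function:
  assumes [measurable]: "\<phi> \<in> borel_measurable borel"
  shows "(\<integral>\<^sup>+y. \<phi> (norm y) \<partial>(lborel :: (real ^ 'd) measure)) = (\<integral>\<^sup>+t. \<phi> t \<partial>radial_measure CARD('d))"
proof -
  interpret S: prob_space "sphere_measure 1 :: (real ^ 'd) measure"
    by (rule prob_space_sphere_measure) simp
  have "(\<integral>\<^sup>+y. \<phi> (norm y) \<partial>(lborel :: (real ^ 'd) measure)) =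
      (\<integral>\<^sup>+t. \<integral>\<^sup>+\<theta>. \<phi> (norm (t *\<^sub>R \<theta>)) \<partial>(sphere_measure 1 :: (real ^ 'd) measure) \<partial>radial_measure CARD('d))"
    by (rule nn_integral_polar) measurable
  also have "\<dots> = (\<integral>\<^sup>+t. \<phi> t \<partial>radial_measure CARD('d))"
  proof (rule nn_integral_cong_AE)
    show "AE t in radial_measure CARD('d).
        (\<integral>\<^sup>+\<theta>. \<phi> (norm (t *\<^sub>R \<theta>)) \<partial>(sphere_measure 1 :: (real ^ 'd) measure)) = \<phi> t"
      using AE_radial_measure_pos
    proof eventually_elim
      fix t :: real assume "t > 0"
      then have "AE \<theta> in (sphere_measure 1 :: (real ^ 'd) measure). \<phi> (norm (t *\<^sub>R \<theta>)) = \<phi> t"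
        using AE_norm_sphere_measure by (auto elim!: eventually_mono)
      then have "(\<integral>\<^sup>+\<theta>. \<phi> (norm (t *\<^sub>R \<theta>)) \<partial>(sphere_measure 1 :: (real ^ 'd) measure)) =
          (\<integral>\<^sup>+\<theta>. \<phi> t \<partial>(sphere_measure 1 :: (real ^ 'd) measure))"
        by (rule nn_integral_cong_AE)
      then show "(\<integral>\<^sup>+\<theta>. \<phi> (norm (t *\<^sub>R \<theta>)) \<partial>(sphere_measure 1 :: (real ^ 'd) measure)) = \<phi> t"
        by (simp add: S.emeasure_space_1)
    qed
  qed
  finally show ?thesis .
qed

text \<open>Pulls the area constant out of the radial measure and leaves the weight t^(n-1) on the
  half-line.\<close>

lemma nn_integral_radial_measure:
  assumes \<phi> [measurable]: "\<phi> \<in> borel_measurable borel" and nonneg: "\<And>t. \<phi> t \<ge> 0"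
  shows "(\<integral>\<^sup>+t. ennreal (\<phi> t) \<partial>radial_measure n) =
    ennreal (real n * unit_ball_vol n) * (\<integral>\<^sup>+t\<in>{0<..}. ennreal (\<phi> t * t ^ (n - 1)) \<partial>lborel)"
proof -
  have "(\<integral>\<^sup>+t. ennreal (\<phi> t) \<partial>radial_measure n) =
      (\<integral>\<^sup>+t. ennreal (real n * unit_ball_vol n) * (ennreal (\<phi> t * t ^ (n - 1)) * indicator {0<..} t) \<partial>lborel)"
    unfolding radial_measure_def
    by (subst nn_integral_density)
       (auto intro!: nn_integral_cong simp: indicator_def nonneg ac_simps simp flip: ennreal_mult)
  then show ?thesis
    by (simp add: nn_integral_cmult)
qed

section \<open>Spherical means\<close>

text \<open>Dilating the argument instead of the sphere gives sensible values at all real t, with g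
  0 at t = 0; this yields continuity on the whole line.\<close>

definition spherical_mean :: "(real ^ 'd \<Rightarrow> complex) \<Rightarrow> real \<Rightarrow> complex" where
  "spherical_mean g t = (LINT \<theta>|sphere_measure 1. g (t *\<^sub>R \<theta>))"

lemma conv_measure_sphere:
  fixes f :: "real ^ 'd \<Rightarrow> complex"
  assumes [measurable]: "f \<in> borel_measurable borel" and t: "t > 0"
  shows "conv_measure (sphere_measure t) f x = spherical_mean (\<lambda>y. f (x - y)) t"
  unfolding conv_measure_def spherical_mean_def sphere_measure_scale[OF t]
  by (subst integral_distr) simp_all

lemma borel_measurable_fourier_sphere [measurable]:
  "fourier_measure (sphere_measure 1 :: (real ^ 'd) measure) \<in> borel_measurable borel"
proof -
  interpret S: prob_space "sphere_measure 1 :: (real ^ 'd) measure"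
    by (rule prob_space_sphere_measure) simp
  show ?thesis
    unfolding fourier_measure_def[abs_def] by measurable
qed

section \<open>The Fourier transform of the sphere measure\<close>

lemma fourier_measure_wave: "fourier_measure \<mu> \<xi> = (LINT y|\<mu>. wave (y \<bullet> \<xi>))"
  by (simp add: fourier_measure_def wave_def)

lemma norm_fourier_measure_le:
  assumes "prob_space \<mu>"
  shows "norm (fourier_measure \<mu> \<xi>) \<le> 1"
proof -
  interpret prob_space \<mu> by fact
  have "norm (fourier_measure \<mu> \<xi>) \<le> (LINT y|\<mu>. norm (wave (y \<bullet> \<xi>)))"
    unfolding fourier_measure_wave by (rule integral_norm_bound)
  then show ?thesis by (simp add: prob_space)
qed

lemma fourier_sphere_scale:
  assumes r: "r > 0"
  shows "fourier_measure (sphere_measure r) \<xi> = fourier_measure (sphere_measure 1) (r *\<^sub>R \<xi>)"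
  unfolding fourier_measure_wave sphere_measure_scale[OF r]
  by (subst integral_distr) simp_all

text \<open>Some orthogonal map takes \<xi> to \<eta>; it preserves both the sphere measure and the
  inner product.\<close>

lemma fourier_sphere_radial:
  fixes \<xi> \<eta> :: "real ^ 'd"
  assumes "norm \<xi> = norm \<eta>"
  shows "fourier_measure (sphere_measure 1) \<xi> = fourier_measure (sphere_measure 1) \<eta>"
proof -
  obtain T where T: "orthogonal_transformation T" "T \<xi> = \<eta>"
    using orthogonal_transformation_exists[OF assms] .
  have "linear T" using T(1) by (rule orthogonal_transformation_linear)
  then have [measurable]: "T \<in> borel_measurable borel"
    by (intro borel_measurable_continuous_onI linear_continuous_on) (simp add: linear_conv_bounded_linear)
  have "fourier_measure (sphere_measure 1) \<eta> = (LINT y|distr (sphere_measure 1) borel T. wave (y \<bullet> T \<xi>))"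
    by (simp add: fourier_measure_wave distr_sphere_measure_orthogonal T)
  also have "\<dots> = (LINT y|sphere_measure 1. wave (T y \<bullet> T \<xi>))"
    by (rule integral_distr) measurable
  also have "\<dots> = fourier_measure (sphere_measure 1) \<xi>"
    using T(1) by (simp add: fourier_measure_wave orthogonal_transformation_def)
  finally show ?thesis ..
qed

section \<open>Spherical means as radial functions, and their Fourier transforms\<close>

context
  fixes g :: "real ^ 'd \<Rightarrow> complex" and M :: real
  assumes int: "integrable lborel g" and cont: "continuous_on UNIV g"
    and bdd: "\<And>y. norm (g y) \<le> M"
begin

lemma integrable_sphere: "integrable (sphere_measure 1) (\<lambda>\<theta>. g (t *\<^sub>R \<theta>))"
proof -
  interpret S: prob_space "sphere_measure 1 :: (real ^ 'd) measure"
    by (rule prob_space_sphere_measure) simp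
  have [measurable]: "g \<in> borel_measurable borel"
    using int by (auto dest: borel_measurable_integrable)
  show ?thesis
    by (rule S.integrable_const_bound[where B = M]) (auto simp: bdd)
qed

lemma norm_spherical_mean_le: "norm (spherical_mean g t) \<le> M"
proof -
  interpret S: prob_space "sphere_measure 1 :: (real ^ 'd) measure"
    by (rule prob_space_sphere_measure) simp
  have "norm (spherical_mean g t) \<le> (LINT \<theta>|(sphere_measure 1 :: (real ^ 'd) measure). M)"
    unfolding spherical_mean_def
    by (rule Bochner_Integration.integral_norm_bound_integral[OF integrable_sphere]) (auto simp: bdd)
  then show ?thesis by (simp add: S.prob_space)
qed

text \<open>Dominated convergence along sequences; the bound M is integrable because the sphere
  measure is finite.\<close>

lemma continuous_spherical_mean: "continuous_on UNIV (spherical_mean g)"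
  unfolding continuous_on_sequentially comp_def
proof (intro ballI allI impI; elim conjE)
  interpret S: prob_space "sphere_measure 1 :: (real ^ 'd) measure"
    by (rule prob_space_sphere_measure) simp
  have [measurable]: "g \<in> borel_measurable borel"
    using int by (auto dest: borel_measurable_integrable)
  fix u :: "nat \<Rightarrow> real" and a assume u: "u \<longlonglongrightarrow> a"
  show "(\<lambda>n. spherical_mean g (u n)) \<longlonglongrightarrow> spherical_mean g a"
    unfolding spherical_mean_def
  proof (rule integral_dominated_convergence)
    show "integrable (sphere_measure 1) (\<lambda>_ :: real ^ 'd. M)" by simp
    show "AE \<theta> in sphere_measure 1. (\<lambda>n. g (u n *\<^sub>R \<theta>)) \<longlonglongrightarrow> g (a *\<^sub>R \<theta>)"
      using cont by (intro AE_I2 isCont_tendsto_compose[of _ g] tendsto_intros u)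
        (simp add: continuous_on_eq_continuous_at)
  qed (auto simp: bdd)
qed

lemma borel_measurable_spherical_mean [measurable]: "spherical_mean g \<in> borel_measurable borel"
  by (intro borel_measurable_continuous_onI continuous_spherical_mean)

text \<open>The modulus of a mean is at most the mean of the modulus, so by polar coordinates the L1
  norm does not exceed that of g.\<close>

lemma integrable_radialization:
  "integrable lborel (\<lambda>y :: real ^ 'd. spherical_mean g (norm y))"
proof (rule integrableI_bounded)
  have [measurable]: "g \<in> borel_measurable borel"
    using int by (auto dest: borel_measurable_integrable)
  have "(\<integral>\<^sup>+y. norm (spherical_mean g (norm (y :: real ^ 'd))) \<partial>lborel) =
      (\<integral>\<^sup>+t. norm (spherical_mean g t) \<partial>radial_measure CARD('d))"
    by (rule nn_integral_radial_function) measurable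
  also have "\<dots> \<le> (\<integral>\<^sup>+t. \<integral>\<^sup>+\<theta>. norm (g (t *\<^sub>R \<theta>)) \<partial>sphere_measure 1 \<partial>radial_measure CARD('d))"
    unfolding spherical_mean_def
    by (intro nn_integral_mono integral_norm_bound_ennreal integrable_sphere)
  also have "\<dots> = (\<integral>\<^sup>+y. norm (g y) \<partial>lborel)"
    by (rule nn_integral_polar[symmetric]) measurable
  also have "\<dots> < \<infinity>"
    using int by (simp add: integrable_iff_bounded)
  finally show "(\<integral>\<^sup>+y. norm (spherical_mean g (norm (y :: real ^ 'd))) \<partial>lborel) < \<infinity>" .
qed measurable

text \<open>Both sides are the Hankel-type transform of the spherical mean of \<open>g\<close>.\<close>
lemma fourier_radialization:
  "fourier (\<lambda>y :: real ^ 'd. spherical_mean g (norm y)) \<xi> =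
    (LINT y|lborel. fourier_measure (sphere_measure 1) (norm \<xi> *\<^sub>R y) * g y)"
proof -
  interpret S: prob_space "sphere_measure 1 :: (real ^ 'd) measure"
    by (rule prob_space_sphere_measure) simp
  have [measurable]: "g \<in> borel_measurable borel"
    using int by (auto dest: borel_measurable_integrable)
  let ?\<sigma> = "sphere_measure 1 :: (real ^ 'd) measure" and ?\<rho> = "radial_measure CARD('d)"
  let ?K = "fourier_measure ?\<sigma>"
  have "fourier (\<lambda>y :: real ^ 'd. spherical_mean g (norm y)) \<xi> =
      (LINT t|?\<rho>. LINT \<theta>|?\<sigma>. spherical_mean g (norm (t *\<^sub>R \<theta>)) * wave ((t *\<^sub>R \<theta>) \<bullet> \<xi>))"
    unfolding fourier_def
    by (intro integral_polar integrable_mult_wave integrable_radialization) measurable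
  \<comment> \<open>For |\<theta>| = 1 and t > 0 the mean depends on t only, and the angular
    integral of the character is \<open>?K (t *\<^sub>R \<xi>)\<close>.\<close>
  also have "\<dots> = (LINT t|?\<rho>. spherical_mean g t * ?K (t *\<^sub>R \<xi>))"
  proof (rule integral_cong_AE)
    show "AE t in ?\<rho>. (LINT \<theta>|?\<sigma>. spherical_mean g (norm (t *\<^sub>R \<theta>)) * wave ((t *\<^sub>R \<theta>) \<bullet> \<xi>)) =
        spherical_mean g t * ?K (t *\<^sub>R \<xi>)"
      using AE_radial_measure_pos
    proof eventually_elim
      fix t :: real assume t: "t > 0"
      have "(LINT \<theta>|?\<sigma>. spherical_mean g (norm (t *\<^sub>R \<theta>)) * wave ((t *\<^sub>R \<theta>) \<bullet> \<xi>)) =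
          (LINT \<theta>|?\<sigma>. spherical_mean g t * wave (\<theta> \<bullet> (t *\<^sub>R \<xi>)))"
        by (rule integral_cong_AE, measurable)
           (use AE_norm_sphere_measure t in \<open>auto elim!: eventually_mono\<close>)
      then show "(LINT \<theta>|?\<sigma>. spherical_mean g (norm (t *\<^sub>R \<theta>)) * wave ((t *\<^sub>R \<theta>) \<bullet> \<xi>)) =
          spherical_mean g t * ?K (t *\<^sub>R \<xi>)"
        by (simp add: fourier_measure_wave)
    qed
  qed measurable
  \<comment> \<open>The vectors t \<xi> and |\<xi>| t \<theta> have equal norms, so by radiality the
    kernel can be moved under the angular integral that defines the mean.\<close>
  also have "\<dots> = (LINT t|?\<rho>. LINT \<theta>|?\<sigma>. ?K (norm \<xi> *\<^sub>R t *\<^sub>R \<theta>) * g (t *\<^sub>R \<theta>))"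
  proof (rule integral_cong_AE)
    show "AE t in ?\<rho>. spherical_mean g t * ?K (t *\<^sub>R \<xi>) =
        (LINT \<theta>|?\<sigma>. ?K (norm \<xi> *\<^sub>R t *\<^sub>R \<theta>) * g (t *\<^sub>R \<theta>))"
      using AE_radial_measure_pos
    proof eventually_elim
      fix t :: real assume t: "t > 0"
      have "(LINT \<theta>|?\<sigma>. ?K (norm \<xi> *\<^sub>R t *\<^sub>R \<theta>) * g (t *\<^sub>R \<theta>)) =
          (LINT \<theta>|?\<sigma>. ?K (t *\<^sub>R \<xi>) * g (t *\<^sub>R \<theta>))"
      proof (rule integral_cong_AE)
        show "AE \<theta> in ?\<sigma>. ?K (norm \<xi> *\<^sub>R t *\<^sub>R \<theta>) * g (t *\<^sub>R \<theta>) = ?K (t *\<^sub>R \<xi>) * g (t *\<^sub>R \<theta>)"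
          using AE_norm_sphere_measure
        proof eventually_elim
          fix \<theta> :: "real ^ 'd" assume "norm \<theta> = 1"
          then have "?K (norm \<xi> *\<^sub>R t *\<^sub>R \<theta>) = ?K (t *\<^sub>R \<xi>)"
            by (intro fourier_sphere_radial) (simp add: abs_mult)
          then show "?K (norm \<xi> *\<^sub>R t *\<^sub>R \<theta>) * g (t *\<^sub>R \<theta>) = ?K (t *\<^sub>R \<xi>) * g (t *\<^sub>R \<theta>)" by simp
        qed
      qed measurable
      then show "spherical_mean g t * ?K (t *\<^sub>R \<xi>) =
          (LINT \<theta>|?\<sigma>. ?K (norm \<xi> *\<^sub>R t *\<^sub>R \<theta>) * g (t *\<^sub>R \<theta>))"
        by (simp add: spherical_mean_def mult.commute)
    qed
  qed measurable
  \<comment> \<open>Polar coordinates are now undone; the integrand is integrable because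
    \<open>?K\<close> is bounded by 1.\<close>
  also have "\<dots> = (LINT y|lborel. ?K (norm \<xi> *\<^sub>R y) * g y)"
  proof (rule integral_polar[symmetric])
    show "integrable lborel (\<lambda>y. ?K (norm \<xi> *\<^sub>R y) * g y)"
    proof (rule Bochner_Integration.integrable_bound[OF int])
      show "AE y in lborel. norm (?K (norm \<xi> *\<^sub>R y) * g y) \<le> norm (g y)"
        using norm_fourier_measure_le[OF S.prob_space_axioms]
        by (auto simp: norm_mult intro!: mult_left_le_one_le)
    qed measurable
  qed
  finally show ?thesis .
qed

text \<open>Plancherel for the radial function y \<mapsto> \<open>spherical_mean g (norm y)\<close>.
  Its transform is radial too, so both squared norms reduce to radial integrals.\<close>

lemma spherical_mean_isometry:
  "(\<integral>\<^sup>+t\<in>{0<..}. ennreal ((cmod (spherical_mean g t))\<^sup>2 * t ^ (CARD('d) - 1)) \<partial>lborel) =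
   (\<integral>\<^sup>+r\<in>{0<..}. ennreal ((cmod (LINT y|lborel. fourier_measure (sphere_measure 1) (r *\<^sub>R y) * g y))\<^sup>2
      * r ^ (CARD('d) - 1)) \<partial>lborel)"
proof -
  have [measurable]: "g \<in> borel_measurable borel"
    using int by (auto dest: borel_measurable_integrable)
  let ?B = "\<lambda>r. LINT y|lborel. fourier_measure (sphere_measure 1) (r *\<^sub>R y) * g y"
  let ?c = "ennreal (real CARD('d) * unit_ball_vol CARD('d))"
  have "?c * (\<integral>\<^sup>+t\<in>{0<..}. ennreal ((cmod (spherical_mean g t))\<^sup>2 * t ^ (CARD('d) - 1)) \<partial>lborel) =
      (\<integral>\<^sup>+t. ennreal ((cmod (spherical_mean g t))\<^sup>2) \<partial>radial_measure CARD('d))"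
    by (subst nn_integral_radial_measure) simp_all
  also have "\<dots> = (\<integral>\<^sup>+y. ennreal ((cmod (spherical_mean g (norm (y :: real ^ 'd))))\<^sup>2) \<partial>lborel)"
    by (rule nn_integral_radial_function[symmetric]) measurable
  also have "\<dots> = (\<integral>\<^sup>+\<xi>. ennreal ((cmod (fourier (\<lambda>y :: real ^ 'd. spherical_mean g (norm y)) \<xi>))\<^sup>2) \<partial>lborel)"
    by (intro plancherel[symmetric, where M = M] integrable_radialization norm_spherical_mean_le
        continuous_on_compose2[OF continuous_spherical_mean] continuous_intros) auto
  also have "\<dots> = (\<integral>\<^sup>+\<xi>. ennreal ((cmod (?B (norm (\<xi> :: real ^ 'd))))\<^sup>2) \<partial>lborel)"
    by (simp only: fourier_radialization)
  also have "\<dots> = (\<integral>\<^sup>+r. ennreal ((cmod (?B r))\<^sup>2) \<partial>radial_measure CARD('d))"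
    by (rule nn_integral_radial_function) measurable
  also have "\<dots> = ?c * (\<integral>\<^sup>+r\<in>{0<..}. ennreal ((cmod (?B r))\<^sup>2 * r ^ (CARD('d) - 1)) \<partial>lborel)"
    by (subst nn_integral_radial_measure) simp_all
  \<comment> \<open>The common factor \<open>?c\<close> is positive and finite, hence may be
    cancelled in \<open>ennreal\<close>.\<close>
  finally show ?thesis
    using unit_ball_vol_pos[of "real CARD('d)", THEN less_imp_neq]
    by (auto simp: ennreal_mult_cancel_left)
qed

end

section \<open>Schwartz functions\<close>

lemma prod_Basis_vec:
  fixes x :: "real ^ 'd"
  shows "(\<Prod>b\<in>Basis. h (x \<bullet> b)) = (\<Prod>i\<in>UNIV. h (x $ i))"
proof -
  have "Basis = (\<lambda>i. axis i 1 :: real ^ 'd) ` UNIV"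
    by (auto simp: Basis_vec_def)
  moreover have "inj (\<lambda>i. axis i 1 :: real ^ 'd)"
    by (simp add: inj_on_def axis_eq_axis)
  ultimately have "(\<Prod>b\<in>Basis. h (x \<bullet> b)) = (\<Prod>i\<in>UNIV. h (x \<bullet> axis i 1))"
    by (metis (no_types, lifting) prod.reindex_cong)
  then show ?thesis
    by (simp add: inner_axis)
qed

lemma schwartz_continuous: "schwartz f \<Longrightarrow> continuous_on UNIV f"
  unfolding schwartz_def smooth_def
  by (metis differentiable_imp_continuous_on foldr.simps(1) id_apply iter_partial_def)

lemma schwartz_bound:
  assumes "schwartz f"
  obtains C where "\<And>x. norm (of_real (multi_power x \<alpha>) * f x) \<le> C"
proof -
  have "bounded (range (\<lambda>x. of_real (multi_power x \<alpha>) * iter_partial [] f x))"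
    using assms unfolding schwartz_def by blast
  then show ?thesis
    using that unfolding bounded_iff by (auto simp: iter_partial_def)
qed

text \<open>Expanding the product over subsets S of the coordinates gives the monomials with
  exponent 2 on S and 0 elsewhere; the Schwartz condition without derivatives bounds each of them
  times f.\<close>

lemma schwartz_decay:
  fixes f :: "real ^ 'd \<Rightarrow> complex"
  assumes f: "schwartz f"
  obtains C where "\<And>x. (\<Prod>i\<in>UNIV. 1 + (x $ i)\<^sup>2) * norm (f x) \<le> C"
proof -
  let ?\<alpha> = "\<lambda>S i. if i \<in> S then 2 else (0::nat)"
  have "\<exists>C. \<forall>x. norm (of_real (multi_power x (?\<alpha> S)) * f x) \<le> C" for S
    using schwartz_bound[OF f] by metis
  then obtain C where C: "\<And>S x. norm (of_real (multi_power x (?\<alpha> S)) * f x) \<le> C S"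
    by metis
  have "(\<Prod>i\<in>UNIV. 1 + (x $ i)\<^sup>2) * norm (f x) \<le> (\<Sum>S\<in>UNIV. C S)" for x
  proof -
    have "multi_power x (?\<alpha> S) = (\<Prod>i\<in>S. (x $ i)\<^sup>2)" for S
      unfolding multi_power_def
      by (simp add: if_distrib[of "power _"] prod.If_cases cong: if_cong)
    then have "(\<Prod>i\<in>UNIV. 1 + (x $ i)\<^sup>2) = (\<Sum>S\<in>UNIV. multi_power x (?\<alpha> S))"
      using prod_add[of UNIV "\<lambda>i. (x $ i)\<^sup>2" "\<lambda>_. 1"] by (simp add: add.commute)
    then have "(\<Prod>i\<in>UNIV. 1 + (x $ i)\<^sup>2) * norm (f x) = (\<Sum>S\<in>UNIV. multi_power x (?\<alpha> S) * norm (f x))"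
      by (simp add: sum_distrib_right)
    also have "\<dots> \<le> (\<Sum>S\<in>UNIV. C S)"
    proof (rule sum_mono)
      fix S
      have "multi_power x (?\<alpha> S) * norm (f x) \<le> norm (of_real (multi_power x (?\<alpha> S)) * f x)"
        by (simp add: norm_mult mult_right_mono)
      then show "multi_power x (?\<alpha> S) * norm (f x) \<le> C S"
        using C order_trans by blast
    qed
    finally show ?thesis .
  qed
  then show ?thesis by (rule that)
qed

text \<open>The majorant is a product of functions 1/(1 + t^2) of single coordinates, so its
  integrability reduces to dimension one.\<close>

lemma schwartz_integrable:
  fixes f :: "real ^ 'd \<Rightarrow> complex"
  assumes f: "schwartz f"
  shows "integrable lborel f"
proof -
  obtain C where C: "\<And>x. (\<Prod>i\<in>UNIV. 1 + (x $ i)\<^sup>2) * norm (f x) \<le> C"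
    using schwartz_decay[OF f] by blast
  have "integrable lborel (\<lambda>t::real. inverse (1 + t\<^sup>2))"
    using integrable_inverse_1_plus_square by (simp add: set_integrable_def)
  then have "integrable lborel (\<lambda>x :: real ^ 'd. C * (\<Prod>b\<in>Basis. inverse (1 + (x \<bullet> b)\<^sup>2)))"
    by (intro integrable_mult_right integrable_lborel_prod)
  then show ?thesis
  proof (rule Bochner_Integration.integrable_bound)
    show "f \<in> borel_measurable lborel"
      using schwartz_continuous[OF f] by (simp add: borel_measurable_continuous_onI)
    show "AE x in lborel. norm (f x) \<le> norm (C * (\<Prod>b\<in>Basis. inverse (1 + (x \<bullet> b)\<^sup>2)))"
    proof (rule AE_I2)
      fix x :: "real ^ 'd"
      have "(\<Prod>i\<in>UNIV. 1 + (x $ i)\<^sup>2) > 0"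
        by (intro prod_pos) (simp add: add_pos_nonneg)
      then have "norm (f x) \<le> C * inverse (\<Prod>i\<in>UNIV. 1 + (x $ i)\<^sup>2)"
        using C[of x] by (simp add: field_simps)
      also have "\<dots> = C * (\<Prod>b\<in>Basis. inverse (1 + (x \<bullet> b)\<^sup>2))"
        by (simp add: prod_inversef[unfolded comp_def] prod_Basis_vec[of "\<lambda>t. 1 + t\<^sup>2"])
      finally show "norm (f x) \<le> norm (C * (\<Prod>b\<in>Basis. inverse (1 + (x \<bullet> b)\<^sup>2)))"
        by simp
    qed
  qed
qed

theorem theorem1p9:
  fixes f :: "real ^ 'd \<Rightarrow> complex" and x :: "real ^ 'd"
  assumes "CARD('d) \<ge> 2"
    and "schwartz f"
  shows "(\<integral>\<^sup>+t\<in>{0<..}. ennreal ((cmod (conv_measure (sphere_measure t) f x))\<^sup>2 * t ^ (CARD('d) - 1)) \<partial>lborel)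
       = (\<integral>\<^sup>+r\<in>{0<..}. ennreal ((cmod (conv_fun (fourier_measure (sphere_measure r)) f x))\<^sup>2 * r ^ (CARD('d) - 1)) \<partial>lborel)"
proof -
  let ?g = "\<lambda>y. f (x - y)"
  have cont: "continuous_on UNIV f" and int: "integrable lborel f"
    using assms(2) by (rule schwartz_continuous, rule schwartz_integrable)
  have [measurable]: "f \<in> borel_measurable borel"
    using cont by (rule borel_measurable_continuous_onI)
  \<comment> \<open>With all exponents 0 the monomial is 1, and the Schwartz bound is a bound on f
    itself.\<close>
  obtain M where M: "\<And>y. norm (f y) \<le> M"
    using schwartz_bound[OF assms(2), of "\<lambda>_. 0"] by (auto simp: multi_power_def)
  have g: "integrable lborel ?g" "continuous_on UNIV ?g"
    using integrable_lborel_affine_iff[of f "-1" x] int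
    by (auto intro!: continuous_intros continuous_on_compose2[OF cont])
  have "(\<integral>\<^sup>+t\<in>{0<..}. ennreal ((cmod (conv_measure (sphere_measure t) f x))\<^sup>2 * t ^ (CARD('d) - 1)) \<partial>lborel)
      = (\<integral>\<^sup>+t\<in>{0<..}. ennreal ((cmod (spherical_mean ?g t))\<^sup>2 * t ^ (CARD('d) - 1)) \<partial>lborel)"
    \<comment> \<open>The two averages are compared for t > 0 only; elsewhere the indicator makes
      both integrands 0.\<close>
    by (intro nn_integral_cong) (auto simp: indicator_def conv_measure_sphere)
  also have "\<dots> = (\<integral>\<^sup>+r\<in>{0<..}. ennreal ((cmod (LINT y|lborel.
      fourier_measure (sphere_measure 1) (r *\<^sub>R y) * ?g y))\<^sup>2 * r ^ (CARD('d) - 1)) \<partial>lborel)"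
    by (rule spherical_mean_isometry[OF g M])
  also have "\<dots> = (\<integral>\<^sup>+r\<in>{0<..}. ennreal ((cmod (conv_fun (fourier_measure (sphere_measure r)) f x))\<^sup>2
      * r ^ (CARD('d) - 1)) \<partial>lborel)"
  proof (rule nn_integral_cong)
    fix r :: real
    show "ennreal ((cmod (LINT y|lborel. fourier_measure (sphere_measure 1) (r *\<^sub>R y) * ?g y))\<^sup>2
          * r ^ (CARD('d) - 1)) * indicator {0<..} r
        = ennreal ((cmod (conv_fun (fourier_measure (sphere_measure r)) f x))\<^sup>2 * r ^ (CARD('d) - 1))
          * indicator {0<..} r"
    proof (cases "r > 0")
      case True
      then show ?thesis
        \<comment> \<open>Dilating the sphere by r dilates the frequency by r, so the kernel at r y
          is the transform of the sphere of radius r at y.\<close>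
        by (simp only: conv_fun_def fourier_sphere_scale[OF True])
    qed simp
  qed
  finally show ?thesis .
qed

end
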